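(* Let $p,N\in\mathbb{N}$ with $p\le N$ and let $S\in \mathrm{O}(N)$. The mapping $\Phi_S:\mathrm{St}(p,N)\setminus E_{N,p}(S)\to Q_{N,p}(S)$ is a diffeomorphism between the subset $\mathrm{St}(p,N)\setminus E_{N,p}(S)$ of $\mathrm{St}(p,N)$ and the vector space $Q_{N,p}(S)$. Its inversion mapping is given by $$\Phi_S^{-1}:Q_{N,p}(S)\to \mathrm{St}(p,N)\setminus E_{N,p}(S):\ V\mapsto \Xi\circ\varphi_S^{-1}(V)=S(I-V)(I+V)^{-1}I_{N\times p},$$ where $\Xi:\mathrm{O}(N)\to\mathrm{St}(p,N):U\mapsto U I_{N\times p}$. Moreover, for every $V\in Q_{N,p}(S)$, $$\Phi_S^{-1}(V)=\Xi\circ\varphi_S^{-1}(V)=2S(I+V)^{-1}I_{N\times p}-S I_{N\times p}$$ $$=2S\begin{bmatrix}M^{-1}\\ -[\![V]\!]_{21}M^{-1}\end{bmatrix}-S_{\rm le}=2\bigl(S_{\rm le}-S_{\rm ri}[\![V]\!]_{21}\bigr)M^{-1}-S_{\rm le},$$ where $M:=I_p+[\![V]\!]_{11}+[\![V]\!]_{21}^{T}[\![V]\!]_{21}\in\mathbb{R}^{p\times p}$ is the Schur complement matrix of $I+V\in\mathbb{R}^{N\times N}$.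
   Context: Notation: $\mathrm{St}(p,N)=\{U\in\mathbb{R}^{N\times p}\mid U^TU=I_p\}$ is the Stiefel manifold (an embedded submanifold of $\mathbb{R}^{N\times p}$), $\mathrm{O}(N)=\mathrm{St}(N,N)$. $I$ is the $N\times N$ identity, $I_{N\times p}$ is the matrix of the first $p$ columns of $I$. For $S\in\mathbb{R}^{N\times N}$, $S_{\rm le}\in\mathbb{R}^{N\times p}$ and $S_{\rm ri}\in\mathbb{R}^{N\times(N-p)}$ are the left and right blocks, $S=[S_{\rm le}\ S_{\rm ri}]$. For $X\in\mathbb{R}^{N\times N}$, $[\![X]\!]_{ij}$ ($i,j\in\{1,2\}$) are the blocks of $X$ for the partition $N=p+(N-p)$ of rows and columns (blocks of size zero are omitted when $p=N$). $\mathrm{Skew}(X)=(X-X^T)/2$ for square $X$. $Q_{N,N}=\{V\in\mathbb{R}^{N\times N}\mid V^T=-V\}$, and $$Q_{N,p}(S):=Q_{N,p}:=\left\{\begin{bmatrix}A&-B^T\\ B&0\end{bmatrix}\ \middle|\ A\in\mathbb{R}^{p\times p},\ A^T=-A,\ B\in\mathbb{R}^{(N-p)\times p}\right\}\subset Q_{N,N}.$$ $E_{N,p}(S):=\{U\in\mathrm{St}(p,N)\mid\det(I_p+S_{\rm le}^TU)=0\}$; in particular $E_{N,N}(S)=\{U\in\mathrm{O}(N)\mid \det(I+S^TU)=0\}$. The generalized left-localized Cayley transform centered at $S\in\mathrm{O}(N)$ is $$\Phi_S:\mathrm{St}(p,N)\setminus E_{N,p}(S)\to Q_{N,p}(S):U\mapsto\begin{bmatrix}A_S(U)&-B_S(U)^T\\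 B_S(U)&0\end{bmatrix},$$ $$A_S(U)=2(I_p+S_{\rm le}^TU)^{-T}\,\mathrm{Skew}(U^TS_{\rm le})\,(I_p+S_{\rm le}^TU)^{-1},\qquad B_S(U)=-S_{\rm ri}^TU(I_p+S_{\rm le}^TU)^{-1}.$$ The left-localized (inverse) Cayley transform is $\varphi_S^{-1}:Q_{N,N}\to\mathrm{O}(N)\setminus E_{N,N}(S):V\mapsto S(I-V)(I+V)^{-1}$. *)

theory Defs
  imports
    "HOL-Analysis.Function_Topology"
    "Jordan_Normal_Form.Gauss_Jordan_Elimination"
    "Jordan_Normal_Form.Determinant"
begin

text \<open>
  Real matrices are those of \<open>Jordan_Normal_Form\<close>, so that the sizes \<open>N\<close>, \<open>p\<close> and \<open>N - p\<close> are
  natural numbers. In particular \<open>p = N\<close> is covered, by blocks with no rows or no columns.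
\<close>

section \<open>Smooth maps between sets of matrices\<close>

text \<open>
  The usual topology of the space of \<open>m \<times> n\<close> matrices, transported from the entries. The entries
  are restricted because \<open>A $$ (i, j)\<close> is meaningless outside the index range.
\<close>

definition mat_topology :: "nat \<Rightarrow> nat \<Rightarrow> real mat topology" where
  "mat_topology m n =
     pullback_topology (carrier_mat m n) (\<lambda>A. restrict (\<lambda>ij. A $$ ij) ({..<m} \<times> {..<n}))
       (product_topology (\<lambda>_. euclideanreal) ({..<m} \<times> {..<n}))"

definition entry_unit_mat :: "nat \<Rightarrow> nat \<Rightarrow> nat \<Rightarrow> nat \<Rightarrow> real mat" where
  "entry_unit_mat m n i j = mat m n (\<lambda>ab. if ab = (i, j) then 1 else 0)"

text \<open>
  \<open>C_mat m n k W f\<close>: on the set \<open>W\<close> (meant to be open) of \<open>m \<times> n\<close> matrices, all partial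
  derivatives of \<open>f\<close> with respect to the matrix entries exist up to order \<open>k\<close> and are continuous.
\<close>

primrec C_mat :: "nat \<Rightarrow> nat \<Rightarrow> nat \<Rightarrow> real mat set \<Rightarrow> (real mat \<Rightarrow> real) \<Rightarrow> bool" where
  "C_mat m n 0 W f \<longleftrightarrow>
     continuous_map (subtopology (mat_topology m n) W) euclideanreal f"
| "C_mat m n (Suc k) W f \<longleftrightarrow>
     continuous_map (subtopology (mat_topology m n) W) euclideanreal f \<and>
     (\<exists>D. \<forall>i<m. \<forall>j<n.
        (\<forall>A\<in>W. ((\<lambda>t. f (A + t \<cdot>\<^sub>m entry_unit_mat m n i j)) has_real_derivative D i j A) (at 0)) \<and>
        C_mat m n k W (D i j))"

definition smooth_on_open_mat ::
  "nat \<Rightarrow> nat \<Rightarrow> nat \<Rightarrow> nat \<Rightarrow> real mat set \<Rightarrow> (real mat \<Rightarrow> real mat) \<Rightarrow> bool" where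
  "smooth_on_open_mat m n m' n' W f \<longleftrightarrow>
     openin (mat_topology m n) W \<and> f \<in> W \<rightarrow> carrier_mat m' n' \<and>
     (\<forall>i<m'. \<forall>j<n'. \<forall>k. C_mat m n k W (\<lambda>A. f A $$ (i, j)))"

text \<open>
  Smoothness on an arbitrary subset \<open>X\<close> of the space of \<open>m \<times> n\<close> matrices: near each of its points,
  the map extends to a smooth map on an open set of the ambient space. For open subsets of embedded
  submanifolds (such as \<open>St(p,N)\<close> minus a closed set) and for linear subspaces, this is smoothness
  with respect to the induced manifold structure.
\<close>

definition smooth_on_mat ::
  "nat \<Rightarrow> nat \<Rightarrow> nat \<Rightarrow> nat \<Rightarrow> real mat set \<Rightarrow> (real mat \<Rightarrow> real mat) \<Rightarrow> bool" where
  "smooth_on_mat m n m' n' X f \<longleftrightarrow>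
     X \<subseteq> carrier_mat m n \<and> f \<in> X \<rightarrow> carrier_mat m' n' \<and>
     (\<forall>A\<in>X. \<exists>W F. A \<in> W \<and> smooth_on_open_mat m n m' n' W F \<and> (\<forall>B\<in>W \<inter> X. F B = f B))"

definition diffeomorphism_mat ::
  "nat \<Rightarrow> nat \<Rightarrow> nat \<Rightarrow> nat \<Rightarrow> real mat set \<Rightarrow> real mat set \<Rightarrow> (real mat \<Rightarrow> real mat) \<Rightarrow> bool" where
  "diffeomorphism_mat m n m' n' X Y f \<longleftrightarrow>
     bij_betw f X Y \<and> smooth_on_mat m n m' n' X f \<and> smooth_on_mat m' n' m n Y (the_inv_into X f)"


section \<open>Matrix notation\<close>

text \<open>Unspecified if \<open>A\<close> is not invertible.\<close>

definition minv :: "real mat \<Rightarrow> real mat" where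
  "minv A = the (mat_inverse A)"

definition Skew :: "real mat \<Rightarrow> real mat" where
  "Skew X = (1 / 2) \<cdot>\<^sub>m (X - transpose_mat X)"

definition left_block :: "nat \<Rightarrow> real mat \<Rightarrow> real mat" where
  "left_block p S = mat (dim_row S) p (\<lambda>(i, j). S $$ (i, j))"

definition right_block :: "nat \<Rightarrow> real mat \<Rightarrow> real mat" where
  "right_block p S = mat (dim_row S) (dim_col S - p) (\<lambda>(i, j). S $$ (i, j + p))"

definition block11 :: "nat \<Rightarrow> real mat \<Rightarrow> real mat" where
  "block11 p X = (case split_block X p p of (X11, X12, X21, X22) \<Rightarrow> X11)"

definition block12 :: "nat \<Rightarrow> real mat \<Rightarrow> real mat" where
  "block12 p X = (case split_block X p p of (X11, X12, X21, X22) \<Rightarrow> X12)"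

definition block21 :: "nat \<Rightarrow> real mat \<Rightarrow> real mat" where
  "block21 p X = (case split_block X p p of (X11, X12, X21, X22) \<Rightarrow> X21)"

definition block22 :: "nat \<Rightarrow> real mat \<Rightarrow> real mat" where
  "block22 p X = (case split_block X p p of (X11, X12, X21, X22) \<Rightarrow> X22)"

definition schur_complement :: "nat \<Rightarrow> real mat \<Rightarrow> real mat" where
  "schur_complement p X = block11 p X - block12 p X * minv (block22 p X) * block21 p X"

text \<open>The first \<open>p\<close> columns of the \<open>N \<times> N\<close> identity matrix.\<close>

definition eye_cols :: "nat \<Rightarrow> nat \<Rightarrow> real mat" where
  "eye_cols N p = left_block p (1\<^sub>m N)"


section \<open>The Stiefel manifold and the Cayley transforms\<close>

definition St :: "nat \<Rightarrow> nat \<Rightarrow> real mat set" where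
  "St p N = {U \<in> carrier_mat N p. transpose_mat U * U = 1\<^sub>m p}"

definition Orth :: "nat \<Rightarrow> real mat set" where
  "Orth N = St N N"

definition Q_skew :: "nat \<Rightarrow> nat \<Rightarrow> real mat set" where
  "Q_skew N p = {four_block_mat A (- transpose_mat B) B (0\<^sub>m (N - p) (N - p)) | A B.
     A \<in> carrier_mat p p \<and> transpose_mat A = - A \<and> B \<in> carrier_mat (N - p) p}"

text \<open>For \<open>p = N\<close> the blocks of size zero disappear and all skew-symmetric matrices remain.\<close>

lemma Q_skew_self: "Q_skew N N = {V \<in> carrier_mat N N. transpose_mat V = - V}"
proof -
  have blk: "four_block_mat A (- transpose_mat B) B (0\<^sub>m (N - N) (N - N)) = A"
    if "A \<in> carrier_mat N N" "B \<in> carrier_mat (N - N) N" for A B :: "real mat"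
    using that by (intro eq_matI) auto
  show ?thesis
  proof (intro equalityI subsetI)
    fix V assume "V \<in> Q_skew N N"
    then show "V \<in> {V \<in> carrier_mat N N. transpose_mat V = - V}"
      unfolding Q_skew_def using blk by force
  next
    fix V :: "real mat" assume V: "V \<in> {V \<in> carrier_mat N N. transpose_mat V = - V}"
    have Z: "0\<^sub>m (N - N) N \<in> carrier_mat (N - N) N" by simp
    from V blk[OF _ Z, of V] Z show "V \<in> Q_skew N N"
      unfolding Q_skew_def by (smt (verit) mem_Collect_eq)
  qed
qed

definition E_sing :: "nat \<Rightarrow> nat \<Rightarrow> real mat \<Rightarrow> real mat set" where
  "E_sing N p S = {U \<in> St p N. det (1\<^sub>m p + transpose_mat (left_block p S) * U) = 0}"

definition A_cayley :: "nat \<Rightarrow> real mat \<Rightarrow> real mat \<Rightarrow> real mat" where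
  "A_cayley p S U =
     (let K = minv (1\<^sub>m p + transpose_mat (left_block p S) * U)
      in 2 \<cdot>\<^sub>m (transpose_mat K * Skew (transpose_mat U * left_block p S) * K))"

definition B_cayley :: "nat \<Rightarrow> real mat \<Rightarrow> real mat \<Rightarrow> real mat" where
  "B_cayley p S U =
     - (transpose_mat (right_block p S) * U * minv (1\<^sub>m p + transpose_mat (left_block p S) * U))"

definition cayley :: "nat \<Rightarrow> nat \<Rightarrow> real mat \<Rightarrow> real mat \<Rightarrow> real mat" where
  "cayley N p S U =
     four_block_mat (A_cayley p S U) (- transpose_mat (B_cayley p S U))
       (B_cayley p S U) (0\<^sub>m (N - p) (N - p))"

text \<open>\<open>cayley_inv N S\<close> is the inverse transform \<open>\<phi>\<^sub>S\<^sup>-\<^sup>1\<close> of the orthogonal group \<open>O(N)\<close>.\<close>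

definition cayley_inv :: "nat \<Rightarrow> real mat \<Rightarrow> real mat \<Rightarrow> real mat" where
  "cayley_inv N S V = S * (1\<^sub>m N - V) * minv (1\<^sub>m N + V)"

definition Xi :: "nat \<Rightarrow> nat \<Rightarrow> real mat \<Rightarrow> real mat" where
  "Xi N p U = U * eye_cols N p"

end

theory Submission
  imports Defs
begin

text \<open>
  In the orthonormal basis given by the columns of \<open>S\<close>, a point \<open>U\<close> of the Stiefel manifold is a
  pair \<open>T = S\<^sub>l\<^sub>e\<^sup>T U\<close>, \<open>R = S\<^sub>r\<^sub>i\<^sup>T U\<close> with \<open>T\<^sup>T T + R\<^sup>T R = 1\<close>. Everything rests on one identity in
  these coordinates: if \<open>K = (1 + T)\<^sup>-\<^sup>1\<close> and \<open>A\<close>, \<open>B\<close> are the blocks of \<open>\<Phi>\<^sub>S(U)\<close>, then the Schur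
  complement \<open>M = 1 + A + B\<^sup>T B\<close> equals \<open>2 K\<close> (\<open>cayley_block_schur\<close>). So \<open>T\<close> and \<open>R\<close> can be read
  off from \<open>A\<close> and \<open>B\<close>, namely \<open>T = 2 M\<^sup>-\<^sup>1 - 1\<close> and \<open>R = - 2 B M\<^sup>-\<^sup>1\<close>, which is
  \<open>U = 2 (S\<^sub>l\<^sub>e - S\<^sub>r\<^sub>i B) M\<^sup>-\<^sup>1 - S\<^sub>l\<^sub>e\<close> (\<open>preimage_cayley\<close>).

  Conversely, let \<open>A\<close> be any skew matrix and \<open>B\<close> any matrix. Then \<open>M\<close> is invertible, because
  \<open>x \<bullet> M x = |x|\<^sup>2 + |B x|\<^sup>2\<close>, and the same formulas define a point of the Stiefel manifold that
  \<open>\<Phi>\<^sub>S\<close> maps to the given blocks (\<open>schur_cayley_block\<close>, \<open>cayley_preimage\<close>). It lies outside the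
  singular set, since \<open>1 + T = 2 M\<^sup>-\<^sup>1\<close>. The equation \<open>(1 + V) [M\<^sup>-\<^sup>1; - B M\<^sup>-\<^sup>1] = [1; 0]\<close> is block
  elimination in \<open>1 + V\<close>; it identifies this point with \<open>S (1 - V) (1 + V)\<^sup>-\<^sup>1 I\<^sub>N\<^sub>\<times>\<^sub>p\<close>.

  Both maps are smooth because they are compositions of matrix sums, products, transposes and
  inverses. Each of the two formulas defines a smooth map on an open set of matrices, namely
  where the matrix to be inverted has nonzero determinant. By Cramer's rule, smoothness of the
  inverse reduces to that of sums, products and reciprocals of real functions.
\<close>

section \<open>Closure properties of \<open>C\<^sup>k\<close> functions of a matrix\<close>

lemma topspace_mat_topology: "topspace (mat_topology m n) = carrier_mat m n"
  by (auto simp: mat_topology_def topspace_pullback_topology)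

lemma continuous_map_entry:
  assumes "i < m" "j < n"
  shows "continuous_map (mat_topology m n) euclideanreal (\<lambda>A. A $$ (i, j))"
proof -
  let ?r = "\<lambda>A::real mat. restrict (\<lambda>ij. A $$ ij) ({..<m} \<times> {..<n})"
  have "continuous_map (mat_topology m n) euclideanreal ((\<lambda>x. x (i, j)) \<circ> ?r)"
    unfolding mat_topology_def
    by (rule continuous_map_pullback, rule continuous_map_product_projection) (use assms in auto)
  then show ?thesis
    using assms by (simp add: o_def)
qed

lemma continuous_map_line:
  assumes "A \<in> carrier_mat m n"
  shows "continuous_map euclideanreal (mat_topology m n) (\<lambda>t. A + t \<cdot>\<^sub>m entry_unit_mat m n i j)"
  unfolding mat_topology_def
proof (rule continuous_map_pullback')
  let ?r = "\<lambda>A::real mat. restrict (\<lambda>ij. A $$ ij) ({..<m} \<times> {..<n})"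
  show "continuous_map euclideanreal (product_topology (\<lambda>_. euclideanreal) ({..<m} \<times> {..<n}))
     (?r \<circ> (\<lambda>t. A + t \<cdot>\<^sub>m entry_unit_mat m n i j))"
  proof (subst continuous_map_componentwise, intro conjI ballI)
    fix k assume k: "k \<in> {..<m} \<times> {..<n}"
    have "((\<lambda>t. (?r \<circ> (\<lambda>t. A + t \<cdot>\<^sub>m entry_unit_mat m n i j)) t k))
       = (\<lambda>t. A $$ k + t * entry_unit_mat m n i j $$ k)"
      using assms k by (auto simp: entry_unit_mat_def)
    then show "continuous_map euclideanreal euclideanreal
        (\<lambda>t. (?r \<circ> (\<lambda>t. A + t \<cdot>\<^sub>m entry_unit_mat m n i j)) t k)"
      by (simp only:) (auto intro!: continuous_intros)
  qed (auto simp: extensional_def)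
  show "topspace euclideanreal \<subseteq>
      (\<lambda>t. A + t \<cdot>\<^sub>m entry_unit_mat m n i j) -` carrier_mat m n"
    using assms by (auto simp: entry_unit_mat_def)
qed

lemma line_zero:
  assumes "A \<in> carrier_mat m n"
  shows "A + 0 \<cdot>\<^sub>m entry_unit_mat m n i j = A"
  using assms by (intro eq_matI) (auto simp: entry_unit_mat_def)

text \<open>
  Partial derivatives are taken along these lines, so on an open set they depend only on the values
  in that set; this makes being \<open>C\<^sup>k\<close> invariant under changes outside the set.
\<close>

lemma eventually_line_in_open:
  assumes W: "openin (mat_topology m n) W" and A: "A \<in> W"
  shows "eventually (\<lambda>t. A + t \<cdot>\<^sub>m entry_unit_mat m n i j \<in> W) (nhds 0)"
proof -
  have Ac: "A \<in> carrier_mat m n"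
    using openin_subset[OF W] A by (auto simp: topspace_mat_topology)
  have "open {t. A + t \<cdot>\<^sub>m entry_unit_mat m n i j \<in> W}"
    using openin_continuous_map_preimage[OF continuous_map_line[OF Ac] W] by simp
  then have "eventually (\<lambda>t. t \<in> {t. A + t \<cdot>\<^sub>m entry_unit_mat m n i j \<in> W}) (nhds 0)"
    by (rule eventually_nhds_in_open) (use line_zero[OF Ac] A in simp)
  then show ?thesis
    by simp
qed

lemma C_mat_continuous:
  "C_mat m n k W f \<Longrightarrow> continuous_map (subtopology (mat_topology m n) W) euclideanreal f"
  by (cases k) auto

lemma C_mat_Suc_imp: "C_mat m n (Suc k) W f \<Longrightarrow> C_mat m n k W f"
proof (induction k arbitrary: f)
  case (Suc k)
  then obtain D where
    D: "\<And>i j A. i < m \<Longrightarrow> j < n \<Longrightarrow> A \<in> W \<Longrightarrow>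
          ((\<lambda>t. f (A + t \<cdot>\<^sub>m entry_unit_mat m n i j)) has_real_derivative D i j A) (at 0)"
      "\<And>i j. i < m \<Longrightarrow> j < n \<Longrightarrow> C_mat m n (Suc k) W (D i j)"
    and c: "continuous_map (subtopology (mat_topology m n) W) euclideanreal f"
    unfolding C_mat.simps(2)[of m n "Suc k"] by blast
  show ?case
    unfolding C_mat.simps(2)[of m n k] using c D Suc.IH by blast
qed simp

lemma C_mat_SucI:
  assumes "continuous_map (subtopology (mat_topology m n) W) euclideanreal f"
    and "\<And>i j A. i < m \<Longrightarrow> j < n \<Longrightarrow> A \<in> W \<Longrightarrow>
          ((\<lambda>t. f (A + t \<cdot>\<^sub>m entry_unit_mat m n i j)) has_real_derivative D i j A) (at 0)"
    and "\<And>i j. i < m \<Longrightarrow> j < n \<Longrightarrow> C_mat m n k W (D i j)"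
  shows "C_mat m n (Suc k) W f"
  using assms unfolding C_mat.simps by blast

lemma C_mat_SucE:
  assumes "C_mat m n (Suc k) W f"
  obtains D where "\<And>i j A. i < m \<Longrightarrow> j < n \<Longrightarrow> A \<in> W \<Longrightarrow>
          ((\<lambda>t. f (A + t \<cdot>\<^sub>m entry_unit_mat m n i j)) has_real_derivative D i j A) (at 0)"
    and "\<And>i j. i < m \<Longrightarrow> j < n \<Longrightarrow> C_mat m n k W (D i j)"
  using assms unfolding C_mat.simps by blast

lemma C_mat_cong:
  assumes W: "openin (mat_topology m n) W" and eq: "\<And>A. A \<in> W \<Longrightarrow> f A = g A"
    and f: "C_mat m n k W f"
  shows "C_mat m n k W g"
proof -
  have c: "continuous_map (subtopology (mat_topology m n) W) euclideanreal g"
    by (rule continuous_map_eq[OF C_mat_continuous[OF f]])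
      (use eq in \<open>auto simp: topspace_subtopology\<close>)
  show ?thesis
  proof (cases k)
    case (Suc k')
    obtain D where
      D: "\<And>i j A. i < m \<Longrightarrow> j < n \<Longrightarrow> A \<in> W \<Longrightarrow>
            ((\<lambda>t. f (A + t \<cdot>\<^sub>m entry_unit_mat m n i j)) has_real_derivative D i j A) (at 0)"
        "\<And>i j. i < m \<Longrightarrow> j < n \<Longrightarrow> C_mat m n k' W (D i j)"
      using C_mat_SucE[OF f[unfolded Suc]] by blast
    show ?thesis
      unfolding Suc
    proof (rule C_mat_SucI[OF c _ D(2)])
      fix i j A assume ij: "i < m" "j < n" and A: "A \<in> W"
      have ev: "eventually (\<lambda>t. f (A + t \<cdot>\<^sub>m entry_unit_mat m n i j)
                        = g (A + t \<cdot>\<^sub>m entry_unit_mat m n i j)) (nhds 0)"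
        using eventually_line_in_open[OF W A] by eventually_elim (rule eq)
      show "((\<lambda>t. g (A + t \<cdot>\<^sub>m entry_unit_mat m n i j)) has_real_derivative D i j A) (at 0)"
        using DERIV_cong_ev[OF refl ev refl] D(1)[OF ij A] by blast
    qed
  qed (use c in simp)
qed

lemma C_mat_const: "C_mat m n k W (\<lambda>_. c)"
proof (induction k arbitrary: c)
  case (Suc k)
  show ?case
    by (rule C_mat_SucI[where D = "\<lambda>_ _ _. 0"]) (use Suc in auto)
qed simp

lemma C_mat_entry:
  assumes W: "W \<subseteq> carrier_mat m n" and a: "a < m" "b < n"
  shows "C_mat m n k W (\<lambda>A. A $$ (a, b))"
proof (cases k)
  case 0
  show ?thesis
    unfolding 0 C_mat.simps
    by (rule continuous_map_from_subtopology[OF continuous_map_entry[OF a]])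
next
  case (Suc k')
  show ?thesis
    unfolding Suc
  proof (rule C_mat_SucI[where D = "\<lambda>i j A. if (a, b) = (i, j) then 1 else 0"])
    fix i j A assume "i < m" "j < n" "A \<in> W"
    then have "(A + t \<cdot>\<^sub>m entry_unit_mat m n i j) $$ (a, b)
        = A $$ (a, b) + t * (if (a, b) = (i, j) then 1 else 0)" for t
      using W a by (auto simp: entry_unit_mat_def)
    then show "((\<lambda>t. (A + t \<cdot>\<^sub>m entry_unit_mat m n i j) $$ (a, b)) has_real_derivative
         (if (a, b) = (i, j) then 1 else 0)) (at 0)"
      by (auto intro!: derivative_eq_intros)
  qed (rule continuous_map_from_subtopology[OF continuous_map_entry[OF a]], rule C_mat_const)
qed

lemma C_mat_add:
  "C_mat m n k W f \<Longrightarrow> C_mat m n k W g \<Longrightarrow> C_mat m n k W (\<lambda>A. f A + g A)"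
proof (induction k arbitrary: f g)
  case 0
  then show ?case by (auto intro!: continuous_intros)
next
  case (Suc k)
  obtain D where D: "\<And>i j A. i < m \<Longrightarrow> j < n \<Longrightarrow> A \<in> W \<Longrightarrow>
          ((\<lambda>t. f (A + t \<cdot>\<^sub>m entry_unit_mat m n i j)) has_real_derivative D i j A) (at 0)"
    "\<And>i j. i < m \<Longrightarrow> j < n \<Longrightarrow> C_mat m n k W (D i j)"
    using C_mat_SucE[OF Suc.prems(1)] by blast
  obtain D' where D': "\<And>i j A. i < m \<Longrightarrow> j < n \<Longrightarrow> A \<in> W \<Longrightarrow>
          ((\<lambda>t. g (A + t \<cdot>\<^sub>m entry_unit_mat m n i j)) has_real_derivative D' i j A) (at 0)"
    "\<And>i j. i < m \<Longrightarrow> j < n \<Longrightarrow> C_mat m n k W (D' i j)"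
    using C_mat_SucE[OF Suc.prems(2)] by blast
  show ?case
    by (rule C_mat_SucI[where D = "\<lambda>i j A. D i j A + D' i j A"])
      (use Suc.IH D D' Suc.prems[THEN C_mat_continuous] in \<open>auto intro!: continuous_intros DERIV_add\<close>)
qed

text \<open>
  The product rule expresses the partial derivatives by products of functions that are again \<open>C\<^sup>k\<close>,
  so the induction closes; it also needs \<open>C\<^sup>k\<^sup>+\<^sup>1 \<subseteq> C\<^sup>k\<close> for the undifferentiated factors.
\<close>

lemma C_mat_mult:
  assumes W: "W \<subseteq> carrier_mat m n"
  shows "C_mat m n k W f \<Longrightarrow> C_mat m n k W g \<Longrightarrow> C_mat m n k W (\<lambda>A. f A * g A)"
proof (induction k arbitrary: f g)
  case 0
  then show ?case by (auto intro!: continuous_intros)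
next
  case (Suc k)
  obtain D where D: "\<And>i j A. i < m \<Longrightarrow> j < n \<Longrightarrow> A \<in> W \<Longrightarrow>
          ((\<lambda>t. f (A + t \<cdot>\<^sub>m entry_unit_mat m n i j)) has_real_derivative D i j A) (at 0)"
    "\<And>i j. i < m \<Longrightarrow> j < n \<Longrightarrow> C_mat m n k W (D i j)"
    using C_mat_SucE[OF Suc.prems(1)] by blast
  obtain D' where D': "\<And>i j A. i < m \<Longrightarrow> j < n \<Longrightarrow> A \<in> W \<Longrightarrow>
          ((\<lambda>t. g (A + t \<cdot>\<^sub>m entry_unit_mat m n i j)) has_real_derivative D' i j A) (at 0)"
    "\<And>i j. i < m \<Longrightarrow> j < n \<Longrightarrow> C_mat m n k W (D' i j)"
    using C_mat_SucE[OF Suc.prems(2)] by blast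
  show ?case
  proof (rule C_mat_SucI[where D = "\<lambda>i j A. D i j A * g A + D' i j A * f A"])
    fix i j A assume ij: "i < m" "j < n" and A: "A \<in> W"
    show "((\<lambda>t. f (A + t \<cdot>\<^sub>m entry_unit_mat m n i j) * g (A + t \<cdot>\<^sub>m entry_unit_mat m n i j))
        has_real_derivative D i j A * g A + D' i j A * f A) (at 0)"
      using DERIV_mult[OF D(1)[OF ij A] D'(1)[OF ij A]] line_zero[of A m n i j] W A by auto
  next
    fix i j assume "i < m" "j < n"
    then show "C_mat m n k W (\<lambda>A. D i j A * g A + D' i j A * f A)"
      using D(2) D'(2) Suc.prems[THEN C_mat_Suc_imp] by (intro C_mat_add Suc.IH)
  qed (use Suc.prems[THEN C_mat_continuous] in \<open>auto intro!: continuous_intros\<close>)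
qed

text \<open>
  The derivative of \<open>1 / f\<close> is \<open>- f' / f\<^sup>2\<close>, a product in which \<open>1 / f\<close> itself is \<open>C\<^sup>k\<close> by induction.
\<close>

lemma C_mat_inverse:
  assumes W: "W \<subseteq> carrier_mat m n" and nz: "\<And>A. A \<in> W \<Longrightarrow> f A \<noteq> 0"
  shows "C_mat m n k W f \<Longrightarrow> C_mat m n k W (\<lambda>A. inverse (f A))"
proof (induction k)
  case 0
  then show ?case using nz by (auto intro!: continuous_intros continuous_map_real_inverse)
next
  case (Suc k)
  obtain D where D: "\<And>i j A. i < m \<Longrightarrow> j < n \<Longrightarrow> A \<in> W \<Longrightarrow>
          ((\<lambda>t. f (A + t \<cdot>\<^sub>m entry_unit_mat m n i j)) has_real_derivative D i j A) (at 0)"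
    "\<And>i j. i < m \<Longrightarrow> j < n \<Longrightarrow> C_mat m n k W (D i j)"
    using C_mat_SucE[OF Suc.prems] by blast
  have IH: "C_mat m n k W (\<lambda>A. inverse (f A))"
    using Suc.IH Suc.prems C_mat_Suc_imp by blast
  show ?case
  proof (rule C_mat_SucI[where D = "\<lambda>i j A. (- 1) * (inverse (f A) * (D i j A * inverse (f A)))"])
    fix i j A assume ij: "i < m" "j < n" and A: "A \<in> W"
    have Ac: "A + 0 \<cdot>\<^sub>m entry_unit_mat m n i j = A"
      using W A by (auto intro: line_zero)
    show "((\<lambda>t. inverse (f (A + t \<cdot>\<^sub>m entry_unit_mat m n i j))) has_real_derivative
           (- 1) * (inverse (f A) * (D i j A * inverse (f A)))) (at 0)"
      using DERIV_inverse'[OF D(1)[OF ij A]] nz[OF A] unfolding Ac by (simp add: mult.assoc)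
  next
    fix i j assume "i < m" "j < n"
    then show "C_mat m n k W (\<lambda>A. (- 1) * (inverse (f A) * (D i j A * inverse (f A))))"
      using D(2) IH by (intro C_mat_mult W C_mat_const)
  qed (use nz Suc.prems[THEN C_mat_continuous] in \<open>auto intro!: continuous_intros continuous_map_real_inverse\<close>)
qed

lemma C_mat_sum:
  "(\<And>x. x \<in> I \<Longrightarrow> C_mat m n k W (f x)) \<Longrightarrow> C_mat m n k W (\<lambda>A. \<Sum>x\<in>I. f x A)"
  by (induction I rule: infinite_finite_induct) (auto intro: C_mat_const C_mat_add)

lemma C_mat_prod:
  assumes "W \<subseteq> carrier_mat m n"
  shows "(\<And>x. x \<in> I \<Longrightarrow> C_mat m n k W (f x)) \<Longrightarrow> C_mat m n k W (\<lambda>A. \<Prod>x\<in>I. f x A)"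
  using assms by (induction I rule: infinite_finite_induct) (auto intro: C_mat_const C_mat_mult)

section \<open>Matrix algebra with side conditions on dimensions\<close>

text \<open>
  Each of the following laws has equations between dimensions as its side conditions. In contrast to
  membership in \<open>carrier_mat\<close>, these introduce no variables that are absent from the left-hand side,
  so the laws can be used as rewrite rules for products of rectangular matrices.
\<close>

lemma mult_assoc_dim:
  "dim_col A = dim_row B \<Longrightarrow> dim_col B = dim_row C \<Longrightarrow> A * B * C = A * (B * (C :: real mat))"
  by (rule assoc_mult_mat) auto

lemma add_mult_dim:
  "dim_row A = dim_row B \<Longrightarrow> dim_col A = dim_col B \<Longrightarrow> dim_col B = dim_row C \<Longrightarrow>
    (A + B) * C = A * C + B * (C :: real mat)"
  by (rule add_mult_distrib_mat[of _ "dim_row B" "dim_col B"]) auto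

lemma mult_add_dim:
  "dim_row B = dim_row C \<Longrightarrow> dim_col B = dim_col C \<Longrightarrow> dim_col A = dim_row C \<Longrightarrow>
    A * (B + C) = A * B + A * (C :: real mat)"
  by (rule mult_add_distrib_mat[of _ "dim_row A" "dim_col A"]) auto

lemma minus_mult_dim:
  "dim_row A = dim_row B \<Longrightarrow> dim_col A = dim_col B \<Longrightarrow> dim_col B = dim_row C \<Longrightarrow>
    (A - B) * C = A * C - B * (C :: real mat)"
  by (rule minus_mult_distrib_mat[of _ "dim_row B" "dim_col B"]) auto

lemma mult_minus_dim:
  "dim_row B = dim_row C \<Longrightarrow> dim_col B = dim_col C \<Longrightarrow> dim_col A = dim_row C \<Longrightarrow>
    A * (B - C) = A * B - A * (C :: real mat)"
  by (rule mult_minus_distrib_mat[of _ "dim_row A" "dim_col A"]) auto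

lemma smult_mult_dim:
  "dim_col A = dim_row B \<Longrightarrow> (k \<cdot>\<^sub>m A) * B = k \<cdot>\<^sub>m (A * (B :: real mat))"
  by (rule mult_smult_assoc_mat[of _ "dim_row A" "dim_col A"]) auto

lemma mult_smult_dim:
  "dim_col A = dim_row B \<Longrightarrow> A * (k \<cdot>\<^sub>m B) = k \<cdot>\<^sub>m (A * (B :: real mat))"
  by (rule mult_smult_distrib[of _ "dim_row A" "dim_col A"]) auto

lemma transpose_mult_dim:
  "dim_col A = dim_row B \<Longrightarrow> transpose_mat (A * B) = transpose_mat B * transpose_mat (A :: real mat)"
  by (rule transpose_mult[of _ "dim_row A" "dim_col A"]) auto

lemma transpose_add_dim:
  "dim_row A = dim_row B \<Longrightarrow> dim_col A = dim_col B \<Longrightarrow>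
    transpose_mat (A + B) = transpose_mat A + transpose_mat (B :: real mat)"
  by (rule transpose_add[of _ "dim_row A" "dim_col A"]) auto

lemma transpose_minus_dim:
  "dim_row A = dim_row B \<Longrightarrow> dim_col A = dim_col B \<Longrightarrow>
    transpose_mat (A - B) = transpose_mat A - transpose_mat (B :: real mat)"
  by (rule transpose_minus[of _ "dim_row A" "dim_col A"]) auto

lemma transpose_smult_dim: "transpose_mat (k \<cdot>\<^sub>m A) = k \<cdot>\<^sub>m transpose_mat (A :: real mat)"
  by (rule eq_matI) auto

lemma one_mult_dim: "dim_row A = n \<Longrightarrow> 1\<^sub>m n * A = (A :: real mat)"
  "dim_col A = n \<Longrightarrow> A * 1\<^sub>m n = A"
  by (auto intro: left_mult_one_mat' right_mult_one_mat')

lemmas mat_expand =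
  mult_assoc_dim add_mult_dim mult_add_dim minus_mult_dim mult_minus_dim smult_mult_dim
  mult_smult_dim transpose_mult_dim transpose_add_dim transpose_minus_dim transpose_smult_dim
  transpose_uminus one_mult_dim

section \<open>Inverse matrices\<close>

text \<open>
  Cramer's rule. It turns the inverse into a formula in the entries, from which smoothness can be
  read off.
\<close>

lemma minv_eq_adj_mat:
  assumes A: "A \<in> carrier_mat n n" and d: "det A \<noteq> 0"
  shows "minv A = inverse (det A) \<cdot>\<^sub>m adj_mat A"
proof -
  let ?B = "inverse (det A) \<cdot>\<^sub>m adj_mat A"
  have B: "?B \<in> carrier_mat n n" "A * ?B = 1\<^sub>m n" "?B * A = 1\<^sub>m n"
    using adj_mat[OF A] d A by (auto simp: mult_smult_distrib[of _ n n _ n] mult_smult_assoc_mat[of _ n n _ n])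
  have "A \<in> Units (ring_mat TYPE(real) n ())"
    using A B unfolding Units_def ring_mat_def by auto
  then obtain C where C: "mat_inverse A = Some C"
    using mat_inverse(1)[OF A, of "()"] by (cases "mat_inverse A") auto
  note C' = mat_inverse(2)[OF A C]
  have "C = C * (A * ?B)" unfolding B(2) using C' by (metis right_mult_one_mat)
  also have "\<dots> = ?B" using A B C' by (subst assoc_mult_mat[symmetric, of _ n n _ n _ n]) auto
  finally show ?thesis using C by (simp add: minv_def)
qed

lemma minv_inverse:
  assumes A: "A \<in> carrier_mat n n" and d: "det A \<noteq> 0"
  shows "minv A \<in> carrier_mat n n" "A * minv A = 1\<^sub>m n" "minv A * A = 1\<^sub>m n"
  using adj_mat[OF A] d A unfolding minv_eq_adj_mat[OF A d]
  by (auto simp: mat_expand)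

lemma minv_unique:
  assumes A: "A \<in> carrier_mat n n" and B: "B \<in> carrier_mat n n" and AB: "A * B = 1\<^sub>m n"
  shows "det A \<noteq> 0" "minv A = B"
proof -
  show d: "det A \<noteq> 0"
    using det_mult[OF A B] AB by auto
  have "minv A = minv A * (A * B)"
    unfolding AB using minv_inverse[OF A d] by simp
  also have "\<dots> = (minv A * A) * B"
    using A B minv_inverse(1)[OF A d] by (simp add: mat_expand)
  also have "\<dots> = B"
    unfolding minv_inverse(3)[OF A d] using B by simp
  finally show "minv A = B" .
qed

lemma invertible_mat_det:
  assumes A: "A \<in> carrier_mat n n" and d: "det A \<noteq> (0 :: real)"
  shows "invertible_mat A"
  unfolding invertible_mat_def inverts_mat_def
  using minv_inverse[OF A d] A by (intro conjI exI[of _ "minv A"]) auto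

section \<open>Smooth matrix-valued maps\<close>

lemma openin_carrier: "openin (mat_topology m n) (carrier_mat m n)"
  using openin_topspace[of "mat_topology m n"] by (simp add: topspace_mat_topology)

lemma smooth_on_open_matI:
  assumes "openin (mat_topology m n) W" "\<And>A. A \<in> W \<Longrightarrow> F A \<in> carrier_mat r c"
    "\<And>i j k. i < r \<Longrightarrow> j < c \<Longrightarrow> C_mat m n k W (\<lambda>A. F A $$ (i, j))"
  shows "smooth_on_open_mat m n r c W F"
  using assms by (auto simp: smooth_on_open_mat_def)

lemma smooth_on_open_matD:
  assumes "smooth_on_open_mat m n r c W F"
  shows "openin (mat_topology m n) W" "W \<subseteq> carrier_mat m n" "A \<in> W \<Longrightarrow> F A \<in> carrier_mat r c"
    "i < r \<Longrightarrow> j < c \<Longrightarrow> C_mat m n k W (\<lambda>A. F A $$ (i, j))"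
  using assms openin_subset[of "mat_topology m n" W]
  by (auto simp: smooth_on_open_mat_def topspace_mat_topology)

text \<open>
  The entries may be replaced by any functions that agree with them on the open set; this covers
  index arithmetic and formulas, such as Cramer's rule, that hold only there.
\<close>

lemma smooth_on_open_mat_by_entries:
  assumes W: "openin (mat_topology m n) W" and F: "\<And>A. A \<in> W \<Longrightarrow> F A \<in> carrier_mat r c"
    and eq: "\<And>A i j. A \<in> W \<Longrightarrow> i < r \<Longrightarrow> j < c \<Longrightarrow> f i j A = F A $$ (i, j)"
    and f: "\<And>i j k. i < r \<Longrightarrow> j < c \<Longrightarrow> C_mat m n k W (f i j)"
  shows "smooth_on_open_mat m n r c W F"
  using W F by (rule smooth_on_open_matI) (auto intro: C_mat_cong[OF W eq f])

lemma smooth_const: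
  "openin (mat_topology m n) W \<Longrightarrow> C \<in> carrier_mat r c \<Longrightarrow> smooth_on_open_mat m n r c W (\<lambda>_. C)"
  by (rule smooth_on_open_matI) (auto intro: C_mat_const)

lemma smooth_id:
  assumes "openin (mat_topology m n) W"
  shows "smooth_on_open_mat m n m n W (\<lambda>A. A)"
  using assms openin_subset[OF assms]
  by (intro smooth_on_open_matI C_mat_entry) (auto simp: topspace_mat_topology)

lemma smooth_transpose:
  assumes F: "smooth_on_open_mat m n r c W F"
  shows "smooth_on_open_mat m n c r W (\<lambda>A. transpose_mat (F A))"
proof (rule smooth_on_open_mat_by_entries[where f = "\<lambda>i j A. F A $$ (j, i)"])
  fix A i j assume "A \<in> W" "i < c" "j < r"
  then show "F A $$ (j, i) = transpose_mat (F A) $$ (i, j)"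
    using smooth_on_open_matD(3)[OF F, of A] by auto
qed (use smooth_on_open_matD[OF F] in auto)

lemma smooth_smult:
  assumes F: "smooth_on_open_mat m n r c W F"
    and s: "\<And>k. C_mat m n k W s"
  shows "smooth_on_open_mat m n r c W (\<lambda>A. s A \<cdot>\<^sub>m F A)"
proof (rule smooth_on_open_mat_by_entries[where f = "\<lambda>i j A. s A * F A $$ (i, j)"])
  fix A i j assume "A \<in> W" "i < r" "j < c"
  then show "s A * F A $$ (i, j) = (s A \<cdot>\<^sub>m F A) $$ (i, j)"
    using smooth_on_open_matD(3)[OF F, of A] by auto
next
  fix i j k assume "i < r" "j < c"
  then show "C_mat m n k W (\<lambda>A. s A * F A $$ (i, j))"
    using smooth_on_open_matD[OF F] s by (intro C_mat_mult)
qed (use smooth_on_open_matD[OF F] in auto)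

lemma smooth_add:
  assumes F: "smooth_on_open_mat m n r c W F" and G: "smooth_on_open_mat m n r c W G"
  shows "smooth_on_open_mat m n r c W (\<lambda>A. F A + G A)"
proof (rule smooth_on_open_mat_by_entries[where f = "\<lambda>i j A. F A $$ (i, j) + G A $$ (i, j)"])
  fix A i j assume "A \<in> W" "i < r" "j < c"
  then show "F A $$ (i, j) + G A $$ (i, j) = (F A + G A) $$ (i, j)"
    using smooth_on_open_matD(3)[OF F, of A] smooth_on_open_matD(3)[OF G, of A] by auto
next
  fix A assume "A \<in> W"
  then show "F A + G A \<in> carrier_mat r c"
    using smooth_on_open_matD(3)[OF F, of A] smooth_on_open_matD(3)[OF G, of A] by auto
qed (use smooth_on_open_matD[OF F] smooth_on_open_matD[OF G] in \<open>auto intro: C_mat_add\<close>)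

lemma smooth_uminus:
  assumes F: "smooth_on_open_mat m n r c W F"
  shows "smooth_on_open_mat m n r c W (\<lambda>A. - F A)"
proof (rule smooth_on_open_mat_by_entries[where f = "\<lambda>i j A. (-1) * F A $$ (i, j)"])
  fix A i j assume "A \<in> W" "i < r" "j < c"
  then show "(-1) * F A $$ (i, j) = (- F A) $$ (i, j)"
    using smooth_on_open_matD(3)[OF F, of A] by auto
next
  fix i j k assume "i < r" "j < c"
  then show "C_mat m n k W (\<lambda>A. (-1) * F A $$ (i, j))"
    using smooth_on_open_matD[OF F] by (intro C_mat_mult C_mat_const)
qed (use smooth_on_open_matD[OF F] in auto)

lemma smooth_minus:
  assumes F: "smooth_on_open_mat m n r c W F" and G: "smooth_on_open_mat m n r c W G"
  shows "smooth_on_open_mat m n r c W (\<lambda>A. F A - G A)"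
proof (rule smooth_on_open_mat_by_entries[where f = "\<lambda>i j A. (F A + - G A) $$ (i, j)"])
  fix A i j assume "A \<in> W" "i < r" "j < c"
  then show "(F A + - G A) $$ (i, j) = (F A - G A) $$ (i, j)"
    using smooth_on_open_matD(3)[OF F, of A] smooth_on_open_matD(3)[OF G, of A] by auto
next
  fix A assume "A \<in> W"
  then show "F A - G A \<in> carrier_mat r c"
    using smooth_on_open_matD(3)[OF F, of A] smooth_on_open_matD(3)[OF G, of A] by auto
qed (use smooth_on_open_matD[OF smooth_add[OF F smooth_uminus[OF G]]] in auto)

lemma smooth_mult:
  assumes F: "smooth_on_open_mat m n r q W F" and G: "smooth_on_open_mat m n q c W G"
  shows "smooth_on_open_mat m n r c W (\<lambda>A. F A * G A)"
proof (rule smooth_on_open_mat_by_entries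
    [where f = "\<lambda>i j A. \<Sum>l\<in>{0..<q}. F A $$ (i, l) * G A $$ (l, j)"])
  fix A i j assume "A \<in> W" "i < r" "j < c"
  then show "(\<Sum>l\<in>{0..<q}. F A $$ (i, l) * G A $$ (l, j)) = (F A * G A) $$ (i, j)"
    using smooth_on_open_matD(3)[OF F, of A] smooth_on_open_matD(3)[OF G, of A]
    by (auto simp: scalar_prod_def)
next
  fix A assume "A \<in> W"
  then show "F A * G A \<in> carrier_mat r c"
    using smooth_on_open_matD(3)[OF F, of A] smooth_on_open_matD(3)[OF G, of A] by auto
next
  fix i j k assume "i < r" "j < c"
  then show "C_mat m n k W (\<lambda>A. \<Sum>l\<in>{0..<q}. F A $$ (i, l) * G A $$ (l, j))"
    using smooth_on_open_matD[OF F] smooth_on_open_matD[OF G] by (intro C_mat_sum C_mat_mult) auto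
qed (rule smooth_on_open_matD[OF F])

lemma smooth_four_block:
  assumes F: "smooth_on_open_mat m n r1 c1 W F" "smooth_on_open_mat m n r1 c2 W G"
    "smooth_on_open_mat m n r2 c1 W H" "smooth_on_open_mat m n r2 c2 W K"
  shows "smooth_on_open_mat m n (r1 + r2) (c1 + c2) W (\<lambda>A. four_block_mat (F A) (G A) (H A) (K A))"
proof (rule smooth_on_open_mat_by_entries[where f =
      "\<lambda>i j. if i < r1 then if j < c1 then (\<lambda>A. F A $$ (i, j)) else (\<lambda>A. G A $$ (i, j - c1))
             else if j < c1 then (\<lambda>A. H A $$ (i - r1, j)) else (\<lambda>A. K A $$ (i - r1, j - c1))"])
  fix A i j assume "A \<in> W" "i < r1 + r2" "j < c1 + c2"
  then show "(if i < r1 then if j < c1 then (\<lambda>A. F A $$ (i, j)) else (\<lambda>A. G A $$ (i, j - c1))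
             else if j < c1 then (\<lambda>A. H A $$ (i - r1, j)) else (\<lambda>A. K A $$ (i - r1, j - c1))) A
     = four_block_mat (F A) (G A) (H A) (K A) $$ (i, j)"
    using F[THEN smooth_on_open_matD(3), of A] by auto
next
  fix A assume "A \<in> W"
  then show "four_block_mat (F A) (G A) (H A) (K A) \<in> carrier_mat (r1 + r2) (c1 + c2)"
    using F[THEN smooth_on_open_matD(3), of A] by auto
qed (use F[THEN smooth_on_open_matD(1)] F[THEN smooth_on_open_matD(4)] in auto)

lemma C_mat_det:
  assumes F: "smooth_on_open_mat m n r r W F"
  shows "C_mat m n k W (\<lambda>A. det (F A))"
proof (rule C_mat_cong[OF smooth_on_open_matD(1)[OF F]])
  show "C_mat m n k W (\<lambda>A. \<Sum>p\<in>{p. p permutes {0..<r}}. signof p * (\<Prod>i\<in>{0..<r}. F A $$ (i, p i)))"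
    using smooth_on_open_matD[OF F] by (intro C_mat_sum C_mat_mult C_mat_const C_mat_prod) auto
qed (simp add: det_def'[OF smooth_on_open_matD(3)[OF F]])

lemma smooth_mat_delete:
  assumes F: "smooth_on_open_mat m n r c W F" and ij: "i < r" "j < c"
  shows "smooth_on_open_mat m n (r - 1) (c - 1) W (\<lambda>A. mat_delete (F A) i j)"
proof (rule smooth_on_open_mat_by_entries[where f =
      "\<lambda>a b A. F A $$ (if a < i then a else Suc a, if b < j then b else Suc b)"])
  fix A a b assume "A \<in> W" "a < r - 1" "b < c - 1"
  then show "F A $$ (if a < i then a else Suc a, if b < j then b else Suc b)
      = mat_delete (F A) i j $$ (a, b)"
    using smooth_on_open_matD(3)[OF F, of A] by (auto simp: mat_delete_def)
qed (use smooth_on_open_matD[OF F] ij in \<open>auto intro: mat_delete_carrier[where m = r and n = c, simplified]\<close>)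

lemma smooth_minv:
  assumes F: "smooth_on_open_mat m n r r W F" and d: "\<And>A. A \<in> W \<Longrightarrow> det (F A) \<noteq> 0"
  shows "smooth_on_open_mat m n r r W (\<lambda>A. minv (F A))"
proof (rule smooth_on_open_mat_by_entries[where f =
      "\<lambda>i j A. inverse (det (F A)) * ((-1) ^ (j + i) * det (mat_delete (F A) j i))"])
  fix A assume A: "A \<in> W"
  show "minv (F A) \<in> carrier_mat r r"
    using minv_eq_adj_mat[OF smooth_on_open_matD(3)[OF F A] d[OF A]]
      adj_mat(1)[OF smooth_on_open_matD(3)[OF F A]] by simp
  fix i j assume "i < r" "j < r"
  then show "inverse (det (F A)) * ((-1) ^ (j + i) * det (mat_delete (F A) j i))
      = minv (F A) $$ (i, j)"
    using smooth_on_open_matD(3)[OF F A]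
    by (simp add: minv_eq_adj_mat[OF smooth_on_open_matD(3)[OF F A] d[OF A]] adj_mat_def cofactor_def)
next
  fix i j k assume "i < r" "j < r"
  then show "C_mat m n k W (\<lambda>A. inverse (det (F A)) * ((-1) ^ (j + i) * det (mat_delete (F A) j i)))"
    using smooth_on_open_matD[OF F] d
    by (intro C_mat_mult C_mat_const C_mat_inverse C_mat_det[OF F] C_mat_det[OF smooth_mat_delete[OF F]])
qed (rule smooth_on_open_matD[OF F])

lemma openin_det_nonzero:
  assumes F: "smooth_on_open_mat m n r r W F"
  shows "openin (mat_topology m n) {A \<in> W. det (F A) \<noteq> 0}"
proof -
  have "continuous_map (subtopology (mat_topology m n) W) euclideanreal (\<lambda>A. det (F A))"
    by (rule C_mat_continuous[OF C_mat_det[OF F]])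
  then have "openin (subtopology (mat_topology m n) W)
      {A \<in> topspace (subtopology (mat_topology m n) W). det (F A) \<in> - {0}}"
    by (rule openin_continuous_map_preimage) auto
  moreover have "{A \<in> topspace (subtopology (mat_topology m n) W). det (F A) \<in> - {0}}
      = {A \<in> W. det (F A) \<noteq> 0}"
    using smooth_on_open_matD(2)[OF F] by (auto simp: topspace_mat_topology)
  ultimately show ?thesis
    using openin_trans_full[OF _ smooth_on_open_matD(1)[OF F]] by simp
qed

lemma smooth_on_mat_subset:
  assumes F: "smooth_on_open_mat m n r c W F" and X: "X \<subseteq> W" and eq: "\<And>A. A \<in> X \<Longrightarrow> F A = f A"
  shows "smooth_on_mat m n r c X f"
  unfolding smooth_on_mat_def
proof (intro conjI ballI exI[of _ W] exI[of _ F])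
  show "X \<subseteq> carrier_mat m n" using smooth_on_open_matD(2)[OF F] X by auto
  show "f \<in> X \<rightarrow> carrier_mat r c"
    using smooth_on_open_matD(3)[OF F] X eq by (metis funcsetI subsetD)
qed (use F X eq in auto)

section \<open>Invertibility of the identity plus a skew and a Gram matrix\<close>

lemma skew_quadratic_form:
  assumes A: "A \<in> carrier_mat n n" and skew: "transpose_mat A = - A" and v: "v \<in> carrier_vec n"
  shows "v \<bullet> (A *\<^sub>v v) = (0 :: real)"
proof -
  have "v \<bullet> (A *\<^sub>v v) = (transpose_mat A *\<^sub>v v) \<bullet> v"
    using transpose_vec_mult_scalar[OF A v v] A v by (simp add: comm_scalar_prod[of _ n])
  also have "\<dots> = - (v \<bullet> (A *\<^sub>v v))"
    unfolding skew using A v by (simp add: comm_scalar_prod[of _ n])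
  finally show ?thesis by simp
qed

text \<open>
  The quadratic form of this matrix is \<open>v \<mapsto> |v|\<^sup>2 + |B v|\<^sup>2\<close>, as the skew part contributes nothing,
  and so its kernel is trivial.
\<close>

lemma det_one_plus_skew_plus_gram:
  assumes A: "A \<in> carrier_mat n n" and skew: "transpose_mat A = - A" and B: "B \<in> carrier_mat q n"
  shows "det (1\<^sub>m n + A + transpose_mat B * B) \<noteq> (0 :: real)"
proof
  let ?M = "1\<^sub>m n + A + transpose_mat B * B"
  have M: "?M \<in> carrier_mat n n" using A B by auto
  assume "det ?M = 0"
  then obtain v where v: "v \<in> carrier_vec n" "v \<noteq> 0\<^sub>v n" "?M *\<^sub>v v = 0\<^sub>v n"
    using det_0_iff_vec_prod_zero[OF M] by auto
  have "?M *\<^sub>v v = v + A *\<^sub>v v + transpose_mat B *\<^sub>v (B *\<^sub>v v)"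
    using A B v by (simp add: add_mult_distrib_mat_vec[of _ n n])
  then have "0 = v \<bullet> (v + A *\<^sub>v v + transpose_mat B *\<^sub>v (B *\<^sub>v v))"
    using v by (metis scalar_prod_right_zero)
  also have "\<dots> = v \<bullet> v + v \<bullet> (A *\<^sub>v v) + v \<bullet> (transpose_mat B *\<^sub>v (B *\<^sub>v v))"
    using A B v by (simp add: scalar_prod_add_distrib[of _ n])
  also have "v \<bullet> (transpose_mat B *\<^sub>v (B *\<^sub>v v)) = (B *\<^sub>v v) \<bullet> (B *\<^sub>v v)"
    using B v transpose_vec_mult_scalar[OF B v(1), of "B *\<^sub>v v"]
    by (simp add: comm_scalar_prod[of v n])
  also have "v \<bullet> (A *\<^sub>v v) = 0"
    by (rule skew_quadratic_form[OF A skew v(1)])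
  finally have "v \<bullet> v + (B *\<^sub>v v) \<bullet> (B *\<^sub>v v) = 0" by simp
  moreover have "v \<bullet> v \<ge> 0" "(B *\<^sub>v v) \<bullet> (B *\<^sub>v v) \<ge> 0"
    by (auto simp: scalar_prod_def intro: sum_nonneg)
  ultimately have "v \<bullet> v = 0" by linarith
  then have "\<forall>i<n. v $ i = 0"
    using v(1) by (auto simp: scalar_prod_def sum_nonneg_eq_0_iff)
  then have "v = 0\<^sub>v n"
    using v(1) by (intro eq_vecI) auto
  with v(2) show False by simp
qed

section \<open>The Cayley transform in block coordinates\<close>

text \<open>
  All terms of \<open>1 + A + B\<^sup>T B\<close> have the form \<open>K\<^sup>T X K\<close>, with \<open>X\<close> equal to \<open>(1 + T)\<^sup>T (1 + T)\<close>,
  \<open>T\<^sup>T - T\<close> and \<open>R\<^sup>T R\<close>. Because \<open>T\<^sup>T T + R\<^sup>T R = 1\<close>, these three add up to \<open>2 (1 + T)\<^sup>T\<close>, and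
  \<open>K\<^sup>T (1 + T)\<^sup>T = 1\<close>.
\<close>

lemma cayley_block_schur:
  assumes T: "T \<in> carrier_mat p p" and R: "R \<in> carrier_mat q p"
    and unit: "transpose_mat T * T + transpose_mat R * R = 1\<^sub>m p"
    and d: "det (1\<^sub>m p + T) \<noteq> 0"
    and K: "K = minv (1\<^sub>m p + T)"
    and A: "A = 2 \<cdot>\<^sub>m (transpose_mat K * Skew (transpose_mat T) * K)" and B: "B = - (R * K)"
  shows "1\<^sub>m p + A + transpose_mat B * B = 2 \<cdot>\<^sub>m K" "transpose_mat A = - A"
proof -
  let ?P = "1\<^sub>m p + T"
  have P: "?P \<in> carrier_mat p p" using T by simp
  note Kinv = minv_inverse[OF P d, folded K]
  have Kt: "transpose_mat K * transpose_mat ?P = 1\<^sub>m p"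
    using T Kinv(1) by (subst transpose_mult_dim[symmetric]) (auto simp: Kinv(2))
  have dims: "dim_row T = p" "dim_col T = p" "dim_row R = q" "dim_col R = p" "dim_row K = p" "dim_col K = p"
    using T R Kinv(1) by auto
  let ?X = "transpose_mat ?P * ?P + (transpose_mat T - T) + transpose_mat R * R"
  have "?X = 2 \<cdot>\<^sub>m transpose_mat ?P"
  proof -
    have "?X = 1\<^sub>m p + 2 \<cdot>\<^sub>m transpose_mat T + (transpose_mat T * T + transpose_mat R * R)"
      using dims by (simp add: mat_expand) (rule eq_matI; simp del: index_mult_mat(1))
    also have "\<dots> = 2 \<cdot>\<^sub>m transpose_mat ?P"
      unfolding unit using dims by (simp add: mat_expand) (rule eq_matI; simp)
    finally show ?thesis .
  qed
  have A': "A = transpose_mat K * (transpose_mat T - T) * K"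
    unfolding A Skew_def using dims by (simp add: mat_expand) (rule eq_matI; simp del: index_mult_mat(1))
  have "1\<^sub>m p + A + transpose_mat B * B
      = (transpose_mat K * transpose_mat ?P) * (?P * K) + transpose_mat K * (transpose_mat T - T) * K
        + transpose_mat K * (transpose_mat R * R) * K"
    unfolding Kt Kinv(2) A' B using dims by (simp add: mat_expand)
  also have "\<dots> = transpose_mat K * ?X * K"
    using dims by (simp add: mat_expand)
  also have "\<dots> = 2 \<cdot>\<^sub>m ((transpose_mat K * transpose_mat ?P) * K)"
    unfolding \<open>?X = _\<close> using dims by (simp add: mat_expand)
  also have "\<dots> = 2 \<cdot>\<^sub>m K"
    unfolding Kt using dims by (simp add: mat_expand)
  finally show "1\<^sub>m p + A + transpose_mat B * B = 2 \<cdot>\<^sub>m K" .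
  show "transpose_mat A = - A"
    unfolding A' using dims by (simp add: mat_expand) (rule eq_matI; simp del: index_mult_mat(1))
qed

text \<open>
  The formulas for \<open>T\<close> and \<open>R\<close> come from solving \<open>M = 2 (1 + T)\<^sup>-\<^sup>1\<close> and \<open>B = - R (1 + T)\<^sup>-\<^sup>1\<close>. The
  first claim holds because the symmetric part of \<open>M\<close> is \<open>1 + B\<^sup>T B\<close>, the fourth because its skew
  part is \<open>A\<close>.
\<close>

lemma schur_cayley_block:
  assumes A: "A \<in> carrier_mat p p" and skew: "transpose_mat A = - A" and B: "B \<in> carrier_mat q p"
    and M: "M = 1\<^sub>m p + A + transpose_mat B * B"
    and J: "J \<in> carrier_mat p p" "M * J = 1\<^sub>m p" "J * M = 1\<^sub>m p"
    and T: "T = 2 \<cdot>\<^sub>m J - 1\<^sub>m p" and R: "R = - (2 \<cdot>\<^sub>m (B * J))"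
  shows "transpose_mat T * T + transpose_mat R * R = 1\<^sub>m p"
    and "det (1\<^sub>m p + T) \<noteq> 0"
    and "minv (1\<^sub>m p + T) = (1 / 2) \<cdot>\<^sub>m M"
    and "2 \<cdot>\<^sub>m (transpose_mat (minv (1\<^sub>m p + T)) * Skew (transpose_mat T) * minv (1\<^sub>m p + T)) = A"
    and "- (R * minv (1\<^sub>m p + T)) = B"
proof -
  have dims: "dim_row A = p" "dim_col A = p" "dim_row B = q" "dim_col B = p" "dim_row J = p" "dim_col J = p"
      "dim_row M = p" "dim_col M = p"
    using A B J M by auto
  have PT: "1\<^sub>m p + T = 2 \<cdot>\<^sub>m J"
    unfolding T using dims by (intro eq_matI) auto
  have H: "(2 \<cdot>\<^sub>m J) * ((1 / 2) \<cdot>\<^sub>m M) = 1\<^sub>m p"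
    using J(3) dims by (simp add: mat_expand) (rule eq_matI; simp)
  have c: "2 \<cdot>\<^sub>m J \<in> carrier_mat p p" "(1 / 2) \<cdot>\<^sub>m M \<in> carrier_mat p p"
    using dims by auto
  show "det (1\<^sub>m p + T) \<noteq> 0" and K: "minv (1\<^sub>m p + T) = (1 / 2) \<cdot>\<^sub>m M"
    unfolding PT using minv_unique[OF c H] by auto
  have Mt: "transpose_mat M = 1\<^sub>m p - A + transpose_mat B * B"
    unfolding M using skew dims by (simp add: mat_expand) (rule eq_matI; simp del: index_mult_mat(1))
  have JMt: "transpose_mat J * transpose_mat M = 1\<^sub>m p" "transpose_mat M * transpose_mat J = 1\<^sub>m p"
    using J dims by (simp_all flip: transpose_mult_dim)
  \<comment> \<open>Cancellation inside products that are associated to the right.\<close>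
  have JM': "J * (M * X) = X" "transpose_mat M * (transpose_mat J * X) = X"
     "transpose_mat J * (transpose_mat M * X) = X" "M * (J * X) = X"
    if "dim_row X = p" for X :: "real mat"
    using that J dims JMt by (simp_all add: mat_expand flip: mult_assoc_dim)
  show "transpose_mat T * T + transpose_mat R * R = 1\<^sub>m p"
  proof -
    have "transpose_mat T * T + transpose_mat R * R
      = 1\<^sub>m p + 4 \<cdot>\<^sub>m (transpose_mat J * ((1\<^sub>m p + transpose_mat B * B) * J)) - 2 \<cdot>\<^sub>m J - 2 \<cdot>\<^sub>m transpose_mat J"
      unfolding T R using dims by (simp add: mat_expand) (rule eq_matI; simp del: index_mult_mat(1))
    also have "1\<^sub>m p + transpose_mat B * B = (1 / 2) \<cdot>\<^sub>m (M + transpose_mat M)"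
      unfolding Mt unfolding M using dims by (intro eq_matI) (simp_all del: index_mult_mat(1))
    also have "4 \<cdot>\<^sub>m (transpose_mat J * (((1 / 2) \<cdot>\<^sub>m (M + transpose_mat M)) * J))
        = 2 \<cdot>\<^sub>m J + 2 \<cdot>\<^sub>m transpose_mat J"
      using dims J(2) by (simp add: mat_expand JM') (rule eq_matI; simp)
    finally show ?thesis
      using dims by (simp add: mat_expand) (rule eq_matI; simp)
  qed
  have Sk: "Skew (transpose_mat T) = transpose_mat J - J"
    unfolding Skew_def T using dims by (simp add: mat_expand) (rule eq_matI; simp)
  have "transpose_mat M * (transpose_mat J - J) * M = M - transpose_mat M"
    using dims J JMt by (simp add: mat_expand JM')
  also have "\<dots> = 2 \<cdot>\<^sub>m A"
    unfolding Mt unfolding M using dims by (intro eq_matI) (simp_all del: index_mult_mat(1))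
  finally have D: "transpose_mat M * (transpose_mat J - J) * M = 2 \<cdot>\<^sub>m A" .
  have "2 \<cdot>\<^sub>m (transpose_mat ((1 / 2) \<cdot>\<^sub>m M) * (transpose_mat J - J) * ((1 / 2) \<cdot>\<^sub>m M))
      = (1 / 2) \<cdot>\<^sub>m (transpose_mat M * (transpose_mat J - J) * M)"
    using dims by (simp add: mat_expand) (rule eq_matI; simp del: index_mult_mat(1))
  also have "\<dots> = A"
    unfolding D by (rule eq_matI) simp_all
  finally show "2 \<cdot>\<^sub>m (transpose_mat (minv (1\<^sub>m p + T)) * Skew (transpose_mat T) * minv (1\<^sub>m p + T)) = A"
    unfolding K Sk .
  show "- (R * minv (1\<^sub>m p + T)) = B"
    unfolding K R using dims J by (simp add: mat_expand) (rule eq_matI; simp)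
qed

section \<open>Orthogonal matrices split into two column blocks\<close>

lemma left_block_carrier: "S \<in> carrier_mat N N \<Longrightarrow> left_block p S \<in> carrier_mat N p"
  by (auto simp: left_block_def)

lemma right_block_carrier: "S \<in> carrier_mat N N \<Longrightarrow> right_block p S \<in> carrier_mat N (N - p)"
  by (auto simp: right_block_def)

lemma mult_append_rows_blocks:
  assumes S: "S \<in> carrier_mat N N" and pN: "p \<le> N"
    and X: "X \<in> carrier_mat p c" and Y: "Y \<in> carrier_mat (N - p) c"
  shows "S * (X @\<^sub>r Y) = left_block p S * X + right_block p S * (Y :: real mat)"
proof -
  \<comment> \<open>With no rows in the lower blocks, \<open>S\<close> is a four-block matrix and the block product rule applies.\<close>
  have "S = four_block_mat (left_block p S) (right_block p S) (0\<^sub>m 0 p) (0\<^sub>m 0 (N - p))"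
    using S pN by (intro eq_matI) (auto simp: left_block_def right_block_def)
  then have "S * (X @\<^sub>r Y)
      = four_block_mat (left_block p S) (right_block p S) (0\<^sub>m 0 p) (0\<^sub>m 0 (N - p)) * (X @\<^sub>r Y)"
    by simp
  also have "\<dots> = left_block p S * X + right_block p S * Y"
    unfolding append_rows_def
    by (subst mult_four_block_mat[OF left_block_carrier[OF S] right_block_carrier[OF S] _ _ X _ Y])
      (use X Y S in \<open>auto simp: left_block_def right_block_def intro!: eq_matI\<close>)
  finally show ?thesis .
qed

text \<open>
  The first four products are the blocks of \<open>S\<^sup>T S\<close>; the last sum is \<open>S S\<^sup>T\<close>, with the sum over the
  columns of \<open>S\<close> split at \<open>p\<close>.
\<close>

lemma orthogonal_block_products:
  assumes S: "S \<in> Orth N" and pN: "p \<le> N"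
  shows "transpose_mat (left_block p S) * left_block p S = 1\<^sub>m p"
    and "transpose_mat (left_block p S) * right_block p S = 0\<^sub>m p (N - p)"
    and "transpose_mat (right_block p S) * left_block p S = 0\<^sub>m (N - p) p"
    and "transpose_mat (right_block p S) * right_block p S = 1\<^sub>m (N - p)"
    and "left_block p S * transpose_mat (left_block p S)
       + right_block p S * transpose_mat (right_block p S) = 1\<^sub>m N"
proof -
  have Sc: "S \<in> carrier_mat N N" and SS: "transpose_mat S * S = 1\<^sub>m N"
    using S by (auto simp: Orth_def St_def)
  have SS': "S * transpose_mat S = 1\<^sub>m N"
    using mat_mult_left_right_inverse[OF _ Sc SS] Sc by simp
  have cols: "i < N \<Longrightarrow> j < N \<Longrightarrow> col S i \<bullet> col S j = (if i = j then 1 else 0)" for i j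
    using arg_cong[OF SS, of "\<lambda>X. X $$ (i, j)"] Sc by simp
  have rows: "i < N \<Longrightarrow> j < N \<Longrightarrow> row S i \<bullet> row S j = (if i = j then 1 else 0)" for i j
    using arg_cong[OF SS', of "\<lambda>X. X $$ (i, j)"] Sc by simp
  have l: "j < p \<Longrightarrow> col (left_block p S) j = col S j" for j
    using Sc pN by (intro eq_vecI) (auto simp: left_block_def)
  have r: "j < N - p \<Longrightarrow> col (right_block p S) j = col S (j + p)" for j
    using Sc pN by (intro eq_vecI) (auto simp: right_block_def)
  have dims: "dim_row (left_block p S) = N" "dim_col (left_block p S) = p"
      "dim_row (right_block p S) = N" "dim_col (right_block p S) = N - p"
    using Sc by (auto simp: left_block_def right_block_def)
  show "transpose_mat (left_block p S) * left_block p S = 1\<^sub>m p"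
    and "transpose_mat (left_block p S) * right_block p S = 0\<^sub>m p (N - p)"
    and "transpose_mat (right_block p S) * left_block p S = 0\<^sub>m (N - p) p"
    and "transpose_mat (right_block p S) * right_block p S = 1\<^sub>m (N - p)"
    using pN by (auto intro!: eq_matI simp: dims l r cols)
  show "left_block p S * transpose_mat (left_block p S)
       + right_block p S * transpose_mat (right_block p S) = 1\<^sub>m N"
  proof (rule eq_matI)
    fix i j assume "i < dim_row (1\<^sub>m N :: real mat)" "j < dim_col (1\<^sub>m N :: real mat)"
    then have ij: "i < N" "j < N" by auto
    have "row S i \<bullet> row S j = (\<Sum>k = 0..<N. S $$ (i, k) * S $$ (j, k))"
      using ij Sc by (simp add: scalar_prod_def)
    also have "\<dots> = (\<Sum>k = 0..<p. S $$ (i, k) * S $$ (j, k)) + (\<Sum>k = p..<N. S $$ (i, k) * S $$ (j, k))"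
      using pN by (simp add: sum.atLeastLessThan_concat)
    also have "(\<Sum>k = p..<N. S $$ (i, k) * S $$ (j, k))
        = (\<Sum>k = 0..<N - p. S $$ (i, k + p) * S $$ (j, k + p))"
      using sum.shift_bounds_nat_ivl[of "\<lambda>k. S $$ (i, k) * S $$ (j, k)" 0 p "N - p"] pN by simp
    finally show "(left_block p S * transpose_mat (left_block p S)
       + right_block p S * transpose_mat (right_block p S)) $$ (i, j) = 1\<^sub>m N $$ (i, j)"
      using ij Sc pN rows[OF ij] by (simp add: left_block_def right_block_def scalar_prod_def)
  qed (use dims in auto)
qed

lemma stiefel_block_coordinates:
  assumes S: "S \<in> Orth N" and pN: "p \<le> N" and U: "U \<in> St p N"
  defines "T \<equiv> transpose_mat (left_block p S) * U" and "R \<equiv> transpose_mat (right_block p S) * U"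
  shows "U = left_block p S * T + right_block p S * R"
    and "transpose_mat T * T + transpose_mat R * R = 1\<^sub>m p"
proof -
  have Sc: "S \<in> carrier_mat N N" using S by (auto simp: Orth_def St_def)
  have Uc: "U \<in> carrier_mat N p" and UU: "transpose_mat U * U = 1\<^sub>m p" using U by (auto simp: St_def)
  note ob = orthogonal_block_products[OF S pN]
  have dims: "dim_row (left_block p S) = N" "dim_col (left_block p S) = p"
      "dim_row (right_block p S) = N" "dim_col (right_block p S) = N - p" "dim_row U = N" "dim_col U = p"
    using Sc Uc by (auto simp: left_block_def right_block_def)
  have "left_block p S * T + right_block p S * R
      = (left_block p S * transpose_mat (left_block p S)
       + right_block p S * transpose_mat (right_block p S)) * U"
    unfolding T_def R_def using dims by (simp add: mat_expand)
  also have "\<dots> = U" unfolding ob(5) using Uc by simp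
  finally show U': "U = left_block p S * T + right_block p S * R" by simp
  have "transpose_mat T * T + transpose_mat R * R
      = transpose_mat U * (left_block p S * T + right_block p S * R)"
    unfolding T_def R_def using dims by (simp add: mat_expand)
  then show "transpose_mat T * T + transpose_mat R * R = 1\<^sub>m p"
    using U' UU by simp
qed

lemma stiefel_from_block_coordinates:
  assumes S: "S \<in> Orth N" and pN: "p \<le> N"
    and T: "T \<in> carrier_mat p p" and R: "R \<in> carrier_mat (N - p) p"
    and unit: "transpose_mat T * T + transpose_mat R * R = 1\<^sub>m p"
  defines "U \<equiv> left_block p S * T + right_block p S * R"
  shows "U \<in> St p N" "transpose_mat (left_block p S) * U = T" "transpose_mat (right_block p S) * U = R"
proof -
  have Sc: "S \<in> carrier_mat N N" using S by (auto simp: Orth_def St_def)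
  note ob = orthogonal_block_products[OF S pN]
  have dims: "dim_row (left_block p S) = N" "dim_col (left_block p S) = p"
      "dim_row (right_block p S) = N" "dim_col (right_block p S) = N - p"
     "dim_row T = p" "dim_col T = p" "dim_row R = N - p" "dim_col R = p"
    using Sc T R by (auto simp: left_block_def right_block_def)
  have canc: "transpose_mat (left_block p S) * (left_block p S * X) = X"
     "transpose_mat (right_block p S) * (left_block p S * X) = 0\<^sub>m (N - p) (dim_col X)"
     if "dim_row X = p" for X
    using that dims ob by (simp_all add: mat_expand flip: mult_assoc_dim)
  have canc': "transpose_mat (left_block p S) * (right_block p S * X) = 0\<^sub>m p (dim_col X)"
     "transpose_mat (right_block p S) * (right_block p S * X) = X"
     if "dim_row X = N - p" for X
    using that dims ob by (simp_all add: mat_expand flip: mult_assoc_dim)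
  show 1: "transpose_mat (left_block p S) * U = T" and 2: "transpose_mat (right_block p S) * U = R"
    unfolding U_def using dims T R by (simp_all add: mat_expand canc canc')
  have "transpose_mat U * U = transpose_mat T * (transpose_mat (left_block p S) * U)
      + transpose_mat R * (transpose_mat (right_block p S) * U)"
    unfolding U_def using dims by (simp add: mat_expand) (rule eq_matI; simp del: index_mult_mat(1))
  then show "U \<in> St p N"
    unfolding St_def 1 2 unit using dims by (auto simp: U_def)
qed

section \<open>The preimage of an element of \<open>Q\<close>\<close>

lemma Q_skewE:
  assumes "V \<in> Q_skew N p"
  obtains A B where "A \<in> carrier_mat p p" "transpose_mat A = - A" "B \<in> carrier_mat (N - p) p"
    "V = four_block_mat A (- transpose_mat B) B (0\<^sub>m (N - p) (N - p))"
  using assms unfolding Q_skew_def by blast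

lemma blocks_of_four_block:
  assumes "A \<in> carrier_mat p p" "B \<in> carrier_mat p q" "C \<in> carrier_mat q p" "D \<in> carrier_mat q q"
  shows "block11 p (four_block_mat A B C D) = A" "block12 p (four_block_mat A B C D) = B"
    "block21 p (four_block_mat A B C D) = C" "block22 p (four_block_mat A B C D) = D"
  using assms
  by (auto simp: block11_def block12_def block21_def block22_def split_block_def Let_def intro!: eq_matI)

lemma eye_cols_append_rows:
  "p \<le> N \<Longrightarrow> eye_cols N p = 1\<^sub>m p @\<^sub>r 0\<^sub>m (N - p) p"
  by (rule eq_matI) (auto simp: eye_cols_def left_block_def append_rows_def)

lemma mult_eye_cols:
  assumes "S \<in> carrier_mat N N" "p \<le> N"
  shows "S * eye_cols N p = left_block p S"
  using assms mult_append_rows_blocks[OF assms, of "1\<^sub>m p" p "0\<^sub>m (N - p) p"]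
  by (simp add: eye_cols_append_rows left_block_carrier right_block_carrier
      right_mult_one_mat[of _ N] right_mult_zero_mat[of _ N "N - p"] left_block_def)

text \<open>
  An element \<open>V\<close> of \<open>Q\<close> with its free blocks \<open>A\<close> and \<open>B\<close> fixed, for use on both sides of the
  bijection: \<open>V\<close> may be given, or it may be the Cayley transform of a point.
\<close>

locale cayley_coordinates =
  fixes p N :: nat and S V A B :: "real mat"
  assumes pN: "p \<le> N" and S: "S \<in> Orth N"
    and A: "A \<in> carrier_mat p p" and skew: "transpose_mat A = - A" and B: "B \<in> carrier_mat (N - p) p"
    and V: "V = four_block_mat A (- transpose_mat B) B (0\<^sub>m (N - p) (N - p))"
begin

definition M where "M = 1\<^sub>m p + A + transpose_mat B * B"

lemma S_carrier: "S \<in> carrier_mat N N"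
  using S by (auto simp: Orth_def St_def)

lemma V_carrier: "V \<in> carrier_mat N N"
  using A pN unfolding V by (auto intro!: carrier_matI)

lemma V_skew: "transpose_mat V = - V"
proof -
  have "transpose_mat V = four_block_mat (- A) (transpose_mat B) (- B) (0\<^sub>m (N - p) (N - p))"
    unfolding V using A B
    by (subst transpose_four_block_mat[of _ p p _ "N - p" _ "N - p"]) (auto simp: skew transpose_uminus)
  also have "\<dots> = - V"
    unfolding V using A B by (intro eq_matI) auto
  finally show ?thesis .
qed

lemma det_one_plus_V: "det (1\<^sub>m N + V) \<noteq> 0"
proof -
  \<comment> \<open>The case of an empty Gram part: a matrix without rows is inserted for \<open>B\<close>.\<close>
  have "1\<^sub>m N + V + transpose_mat (0\<^sub>m 0 N) * 0\<^sub>m 0 N = 1\<^sub>m N + V"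
    using V_carrier by (intro eq_matI) (auto simp: scalar_prod_def)
  then show ?thesis
    using det_one_plus_skew_plus_gram[OF V_carrier V_skew, of "0\<^sub>m 0 N" 0] by simp
qed

lemma M_carrier: "M \<in> carrier_mat p p"
  using A B by (auto simp: M_def)

lemma det_M: "det M \<noteq> 0"
  unfolding M_def by (rule det_one_plus_skew_plus_gram[OF A skew B])

lemmas minv_M = minv_inverse[OF M_carrier det_M]
lemmas minv_one_plus_V = minv_inverse[OF _ det_one_plus_V]

lemma blocks_V: "block11 p V = A" "block21 p V = B"
  unfolding V by (rule blocks_of_four_block[where q = "N - p"]; use A B in simp)+

lemma one_plus_V: "1\<^sub>m N + V = four_block_mat (1\<^sub>m p + A) (- transpose_mat B) B (1\<^sub>m (N - p))"
  using A B pN unfolding V by (intro eq_matI) auto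

lemma schur_complement_one_plus_V: "schur_complement p (1\<^sub>m N + V) = M"
proof -
  have "minv (1\<^sub>m (N - p)) = 1\<^sub>m (N - p)"
    by (rule minv_unique(2)) auto
  moreover have "block11 p (1\<^sub>m N + V) = 1\<^sub>m p + A" "block12 p (1\<^sub>m N + V) = - transpose_mat B"
    "block21 p (1\<^sub>m N + V) = B" "block22 p (1\<^sub>m N + V) = 1\<^sub>m (N - p)"
    unfolding one_plus_V by (rule blocks_of_four_block[where q = "N - p"]; use A B in simp)+
  ultimately show ?thesis
    using A B unfolding schur_complement_def M_def
    by (simp add: mat_expand) (rule eq_matI; simp del: index_mult_mat(1))
qed

text \<open>
  Block elimination: multiplying the right-hand side by \<open>1 + V\<close> gives \<open>M M\<^sup>-\<^sup>1 = 1\<close> in the upper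
  block and \<open>B M\<^sup>-\<^sup>1 - B M\<^sup>-\<^sup>1 = 0\<close> in the lower one.
\<close>

lemma minv_one_plus_V_eye_cols:
  "minv (1\<^sub>m N + V) * eye_cols N p = minv M @\<^sub>r (- (B * minv M))"
proof -
  define J where "J = minv M"
  let ?Y = "J @\<^sub>r (- (B * J))"
  have J: "J \<in> carrier_mat p p" and MJ: "M * J = 1\<^sub>m p" unfolding J_def by (rule minv_M)+
  have BJ: "- (B * J) \<in> carrier_mat (N - p) p" using B J by auto
  have Y: "?Y \<in> carrier_mat N p"
    using carrier_append_rows[OF J BJ] pN by simp
  have IV: "1\<^sub>m N + V \<in> carrier_mat N N" using V_carrier by simp
  have "(1\<^sub>m N + V) * ?Y = four_block_mat ((1\<^sub>m p + A) * J + - transpose_mat B * - (B * J))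
       ((1\<^sub>m p + A) * 0\<^sub>m p 0 + - transpose_mat B * 0\<^sub>m (N - p) 0)
       (B * J + 1\<^sub>m (N - p) * - (B * J)) (B * 0\<^sub>m p 0 + 1\<^sub>m (N - p) * 0\<^sub>m (N - p) 0)"
    unfolding one_plus_V append_rows_def
    by (subst mult_four_block_mat[of _ p p _ "N - p" _ "N - p"]) (use A B J in auto)
  also have "(1\<^sub>m p + A) * J + - transpose_mat B * - (B * J) = M * J"
    unfolding M_def using A B J by (simp add: mat_expand)
  also have "\<dots> = 1\<^sub>m p" by (rule MJ)
  also have "B * J + 1\<^sub>m (N - p) * - (B * J) = 0\<^sub>m (N - p) p"
    using B J by (simp add: mat_expand) (rule eq_matI; simp del: index_mult_mat(1))
  finally have "(1\<^sub>m N + V) * ?Y = eye_cols N p"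
    using pN B by (auto simp: eye_cols_append_rows append_rows_def intro!: eq_matI)
  then have "minv (1\<^sub>m N + V) * eye_cols N p = (minv (1\<^sub>m N + V) * (1\<^sub>m N + V)) * ?Y"
    using minv_one_plus_V(1)[OF IV] IV Y by (simp add: mat_expand)
  also have "\<dots> = ?Y"
    unfolding minv_one_plus_V(3)[OF IV] using Y by simp
  finally show ?thesis unfolding J_def .
qed

text \<open>
  This is \<open>1 - V = 2 - (1 + V)\<close>, multiplied by \<open>(1 + V)\<^sup>-\<^sup>1\<close>.
\<close>

lemma cayley_inv_eye_cols:
  "S * (1\<^sub>m N - V) * minv (1\<^sub>m N + V) * eye_cols N p
     = 2 \<cdot>\<^sub>m (S * minv (1\<^sub>m N + V) * eye_cols N p) - S * eye_cols N p"
proof -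
  have IV: "1\<^sub>m N + V \<in> carrier_mat N N" using V_carrier by simp
  note K = minv_one_plus_V[OF IV]
  have E: "eye_cols N p \<in> carrier_mat N p" by (simp add: eye_cols_def left_block_def)
  have "1\<^sub>m N - V = 2 \<cdot>\<^sub>m 1\<^sub>m N - (1\<^sub>m N + V)"
    using V_carrier by (intro eq_matI) auto
  then have "S * (1\<^sub>m N - V) * minv (1\<^sub>m N + V) * eye_cols N p
     = S * (2 \<cdot>\<^sub>m minv (1\<^sub>m N + V) - (1\<^sub>m N + V) * minv (1\<^sub>m N + V)) * eye_cols N p"
    using S_carrier V_carrier K(1) E by (simp add: mat_expand)
  also have "\<dots> = 2 \<cdot>\<^sub>m (S * minv (1\<^sub>m N + V) * eye_cols N p) - S * eye_cols N p"
    unfolding K(2) using S_carrier K(1) E by (simp add: mat_expand)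
  finally show ?thesis .
qed

lemma inverse_append_rows:
  "2 \<cdot>\<^sub>m (S * minv (1\<^sub>m N + V) * eye_cols N p) - S * eye_cols N p
     = 2 \<cdot>\<^sub>m (S * (minv M @\<^sub>r (- (B * minv M)))) - left_block p S"
proof -
  have "1\<^sub>m N + V \<in> carrier_mat N N" using V_carrier by simp
  note K = minv_one_plus_V(1)[OF this]
  have "S * minv (1\<^sub>m N + V) * eye_cols N p = S * (minv (1\<^sub>m N + V) * eye_cols N p)"
    using S_carrier K by (intro mult_assoc_dim) (auto simp: eye_cols_def left_block_def)
  then show ?thesis
    by (simp add: minv_one_plus_V_eye_cols mult_eye_cols[OF S_carrier pN])
qed

lemma inverse_blocks:
  "2 \<cdot>\<^sub>m (S * (minv M @\<^sub>r (- (B * minv M)))) - left_block p S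
     = 2 \<cdot>\<^sub>m ((left_block p S - right_block p S * B) * minv M) - left_block p S"
  using mult_append_rows_blocks[OF S_carrier pN, of "minv M" p "- (B * minv M)"] minv_M(1) B
    left_block_carrier[OF S_carrier, of p] right_block_carrier[OF S_carrier, of p]
  by (simp add: mat_expand) (rule eq_matI; simp del: index_mult_mat(1))

definition preimage where
  "preimage = 2 \<cdot>\<^sub>m ((left_block p S - right_block p S * B) * minv M) - left_block p S"

text \<open>
  In the coordinates \<open>T\<close>, \<open>R\<close> this is \<open>schur_cayley_block\<close>.
\<close>

lemma cayley_preimage:
  "preimage \<in> St p N - E_sing N p S" "cayley N p S preimage = V"
proof -
  define T where "T = 2 \<cdot>\<^sub>m minv M - 1\<^sub>m p"
  define R where "R = - (2 \<cdot>\<^sub>m (B * minv M))"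
  have T: "T \<in> carrier_mat p p" and R: "R \<in> carrier_mat (N - p) p"
    using minv_M(1) B by (auto simp: T_def R_def)
  have U_eq: "preimage = left_block p S * T + right_block p S * R"
    unfolding preimage_def T_def R_def
    using minv_M(1) B left_block_carrier[OF S_carrier, of p] right_block_carrier[OF S_carrier, of p]
    by (simp add: mat_expand) (rule eq_matI; simp del: index_mult_mat(1))
  note core = schur_cayley_block[OF A skew B M_def minv_M T_def R_def]
  note sb = stiefel_from_block_coordinates[OF S pN T R core(1), folded U_eq]
  show "preimage \<in> St p N - E_sing N p S"
    using sb(1) core(2) by (simp add: E_sing_def sb(2))
  have preimage_carrier: "preimage \<in> carrier_mat N p" using sb(1) by (simp add: St_def)
  have "transpose_mat preimage * left_block p S = transpose_mat T"
    unfolding sb(2)[symmetric] using preimage_carrier left_block_carrier[OF S_carrier, of p]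
    by (simp add: mat_expand)
  then have "A_cayley p S preimage = A" "B_cayley p S preimage = B"
    using core(4,5) by (simp_all add: A_cayley_def B_cayley_def sb Let_def)
  then show "cayley N p S preimage = V"
    by (simp add: cayley_def V)
qed

end

text \<open>
  The Schur complement of \<open>1 + \<Phi>\<^sub>S(U)\<close> is \<open>2 K\<close> with \<open>K = (1 + T)\<^sup>-\<^sup>1\<close>. Inserting its inverse
  \<open>(1 + T) / 2\<close> and \<open>B = - R K\<close> into the formula for the preimage gives \<open>S\<^sub>l\<^sub>e T + S\<^sub>r\<^sub>i R\<close>, which is
  \<open>U\<close>.
\<close>

lemma preimage_cayley:
  assumes pN: "p \<le> N" and S: "S \<in> Orth N" and U: "U \<in> St p N - E_sing N p S"
  shows "cayley_coordinates p N S (cayley N p S U) (A_cayley p S U) (B_cayley p S U)"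
    and "cayley_coordinates.preimage p S (A_cayley p S U) (B_cayley p S U) = U"
proof -
  have Sc: "S \<in> carrier_mat N N" using S by (auto simp: Orth_def St_def)
  define T where "T = transpose_mat (left_block p S) * U"
  define R where "R = transpose_mat (right_block p S) * U"
  define K where "K = minv (1\<^sub>m p + T)"
  have Uc: "U \<in> carrier_mat N p" and US: "U \<in> St p N" using U by (auto simp: St_def)
  have T: "T \<in> carrier_mat p p" and R: "R \<in> carrier_mat (N - p) p"
    using Uc left_block_carrier[OF Sc, of p] right_block_carrier[OF Sc, of p] by (auto simp: T_def R_def)
  note sb = stiefel_block_coordinates[OF S pN US, folded T_def R_def]
  have d: "det (1\<^sub>m p + T) \<noteq> 0" using U by (auto simp: E_sing_def T_def)
  have Tt: "transpose_mat U * left_block p S = transpose_mat T"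
    unfolding T_def using Uc left_block_carrier[OF Sc, of p] by (simp add: mat_expand)
  have Aeq: "A_cayley p S U = 2 \<cdot>\<^sub>m (transpose_mat K * Skew (transpose_mat T) * K)"
    by (simp add: A_cayley_def Let_def Tt K_def flip: T_def)
  have Beq: "B_cayley p S U = - (R * K)"
    by (simp add: B_cayley_def K_def flip: T_def R_def)
  note core = cayley_block_schur[OF T R sb(2) d K_def Aeq Beq]
  have PK: "K \<in> carrier_mat p p" "K * (1\<^sub>m p + T) = 1\<^sub>m p"
    using minv_inverse[OF _ d] T by (auto simp: K_def)
  show cc: "cayley_coordinates p N S (cayley N p S U) (A_cayley p S U) (B_cayley p S U)"
    by unfold_locales
      (use pN S core(2) Aeq Beq PK(1) T R in \<open>auto simp: cayley_def Skew_def\<close>)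
  interpret cayley_coordinates p N S "cayley N p S U" "A_cayley p S U" "B_cayley p S U" by (rule cc)
  have M: "M = 2 \<cdot>\<^sub>m K" unfolding M_def by (rule core(1))
  have PTc: "(1 / 2) \<cdot>\<^sub>m (1\<^sub>m p + T) \<in> carrier_mat p p" using T by simp
  have "M * ((1 / 2) \<cdot>\<^sub>m (1\<^sub>m p + T)) = K * (1\<^sub>m p + T)"
    unfolding M using PK(1) T by (simp add: mat_expand) (rule eq_matI; simp del: index_mult_mat(1))
  then have "M * ((1 / 2) \<cdot>\<^sub>m (1\<^sub>m p + T)) = 1\<^sub>m p" unfolding PK(2) .
  then have J: "minv M = (1 / 2) \<cdot>\<^sub>m (1\<^sub>m p + T)"
    by (rule minv_unique(2)[OF M_carrier PTc])
  have KP: "K * ((1 / 2) \<cdot>\<^sub>m (1\<^sub>m p + T)) = (1 / 2) \<cdot>\<^sub>m 1\<^sub>m p"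
    using PK T by (simp add: mult_smult_dim)
  have RKP: "R * K * ((1 / 2) \<cdot>\<^sub>m (1\<^sub>m p + T)) = (1 / 2) \<cdot>\<^sub>m R"
    using PK(1) T R by (subst mult_assoc_dim) (auto simp: KP mult_smult_dim one_mult_dim)
  have "(left_block p S - right_block p S * - (R * K)) * ((1 / 2) \<cdot>\<^sub>m (1\<^sub>m p + T))
      = left_block p S * ((1 / 2) \<cdot>\<^sub>m (1\<^sub>m p + T))
        + right_block p S * (R * K * ((1 / 2) \<cdot>\<^sub>m (1\<^sub>m p + T)))"
    using PK(1) T R left_block_carrier[OF Sc, of p] right_block_carrier[OF Sc, of p]
    by (simp add: mat_expand) (rule eq_matI; simp add: field_simps del: index_mult_mat(1))
  also have "2 \<cdot>\<^sub>m \<dots> - left_block p S = left_block p S * T + right_block p S * R"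
    unfolding RKP using T R left_block_carrier[OF Sc, of p] right_block_carrier[OF Sc, of p]
    by (simp add: mat_expand) (rule eq_matI; simp add: field_simps del: index_mult_mat(1))
  finally show "cayley_coordinates.preimage p S (A_cayley p S U) (B_cayley p S U) = U"
    unfolding preimage_def J unfolding Beq sb(1)[symmetric] .
qed

section \<open>Smoothness of the transform and of its inverse\<close>

text \<open>
  The formula for \<open>\<Phi>\<^sub>S\<close> makes sense for every matrix with \<open>det (1 + S\<^sub>l\<^sub>e\<^sup>T U) \<noteq> 0\<close>, not only on the
  Stiefel manifold, and this gives the required extension to an open set of the ambient space.
\<close>

lemma cayley_smooth:
  assumes pN: "p \<le> N" and S: "S \<in> carrier_mat N N"
  shows "smooth_on_mat N p N N (St p N - E_sing N p S) (cayley N p S)"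
proof -
  let ?C = "carrier_mat N p :: real mat set"
  let ?F = "\<lambda>U. 1\<^sub>m p + transpose_mat (left_block p S) * U"
  note lr = left_block_carrier[OF S, of p] right_block_carrier[OF S, of p]
  have F: "smooth_on_open_mat N p p p W ?F" if "openin (mat_topology N p) W" for W
    using that lr by (intro smooth_add smooth_mult[where q = N] smooth_const smooth_id) auto
  define W where "W = {U \<in> ?C. det (?F U) \<noteq> 0}"
  have W: "openin (mat_topology N p) W"
    unfolding W_def by (rule openin_det_nonzero[OF F[OF openin_carrier]])
  have K: "smooth_on_open_mat N p p p W (\<lambda>U. minv (?F U))"
    by (rule smooth_minv[OF F[OF W]]) (simp add: W_def)
  have Sk: "smooth_on_open_mat N p p p W (\<lambda>U. Skew (transpose_mat U * left_block p S))"
    unfolding Skew_def using lr W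
    by (intro smooth_smult smooth_minus smooth_transpose smooth_mult[where q = N] smooth_const smooth_id C_mat_const) auto
  have A: "smooth_on_open_mat N p p p W (A_cayley p S)"
    unfolding A_cayley_def Let_def
    by (intro smooth_smult C_mat_const smooth_mult[where q = p] smooth_transpose K Sk)
  have B: "smooth_on_open_mat N p (N - p) p W (B_cayley p S)"
    unfolding B_cayley_def using lr W
    by (intro smooth_uminus smooth_mult[where q = p, OF _ K] smooth_mult[where q = N] smooth_const smooth_id) auto
  have "smooth_on_open_mat N p (p + (N - p)) (p + (N - p)) W (cayley N p S)"
    unfolding cayley_def using W
    by (intro smooth_four_block A B smooth_uminus smooth_transpose smooth_const) auto
  then have "smooth_on_open_mat N p N N W (cayley N p S)" using pN by simp
  then show ?thesis
    by (rule smooth_on_mat_subset) (auto simp: W_def St_def E_sing_def)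
qed

text \<open>
  The function \<open>f\<close> will be the set-theoretic inverse of \<open>\<Phi>\<^sub>S\<close>, about which nothing is known outside
  \<open>Q\<close>; the formula on the right extends it to the open set where \<open>1 + V\<close> is invertible.
\<close>

lemma cayley_inverse_smooth:
  assumes pN: "p \<le> N" and S: "S \<in> carrier_mat N N" and Q: "Q \<subseteq> carrier_mat N N"
    and d: "\<And>V. V \<in> Q \<Longrightarrow> det (1\<^sub>m N + V) \<noteq> 0"
    and f: "\<And>V. V \<in> Q \<Longrightarrow> f V = S * (1\<^sub>m N - V) * minv (1\<^sub>m N + V) * eye_cols N p"
  shows "smooth_on_mat N N N p Q f"
proof -
  have F: "smooth_on_open_mat N N N N W (\<lambda>V. 1\<^sub>m N + V)" if "openin (mat_topology N N) W" for W
    using that by (intro smooth_add smooth_const smooth_id) auto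
  define W where "W = {V \<in> carrier_mat N N. det (1\<^sub>m N + V) \<noteq> (0::real)}"
  have W: "openin (mat_topology N N) W"
    unfolding W_def by (rule openin_det_nonzero[OF F[OF openin_carrier]])
  have K: "smooth_on_open_mat N N N N W (\<lambda>V. minv (1\<^sub>m N + V))"
    by (rule smooth_minv[OF F[OF W]]) (simp add: W_def)
  have "smooth_on_open_mat N N N p W (\<lambda>V. S * (1\<^sub>m N - V) * minv (1\<^sub>m N + V) * eye_cols N p)"
    using S W
    by (intro smooth_mult[where q = N] K smooth_minus smooth_const smooth_id)
      (auto simp: eye_cols_def left_block_def)
  then show ?thesis
    by (rule smooth_on_mat_subset) (use Q d f in \<open>auto simp: W_def\<close>)
qed

section \<open>The diffeomorphism and its inverse\<close>

theorem proposition2p2: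
  fixes p N :: nat and S :: "real mat"
  assumes "p \<le> N" and "S \<in> Orth N"
  shows
    "diffeomorphism_mat N p N N (St p N - E_sing N p S) (Q_skew N p) (cayley N p S) \<and>
     (\<forall>V \<in> Q_skew N p.
        let \<Phi>_inv = the_inv_into (St p N - E_sing N p S) (cayley N p S);
            S_le = left_block p S;
            S_ri = right_block p S;
            V21 = block21 p V;
            M = 1\<^sub>m p + block11 p V + transpose_mat V21 * V21
        in invertible_mat (1\<^sub>m N + V) \<and>
           \<Phi>_inv V = (Xi N p \<circ> cayley_inv N S) V \<and>
           \<Phi>_inv V = S * (1\<^sub>m N - V) * minv (1\<^sub>m N + V) * eye_cols N p \<and>
           \<Phi>_inv V = 2 \<cdot>\<^sub>m (S * minv (1\<^sub>m N + V) * eye_cols N p) - S * eye_cols N p \<and>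
           M = schur_complement p (1\<^sub>m N + V) \<and>
           invertible_mat M \<and>
           \<Phi>_inv V = 2 \<cdot>\<^sub>m (S * (minv M @\<^sub>r (- (V21 * minv M)))) - S_le \<and>
           \<Phi>_inv V = 2 \<cdot>\<^sub>m ((S_le - S_ri * V21) * minv M) - S_le)"
proof (intro conjI ballI)
  have Sc: "S \<in> carrier_mat N N" using assms(2) by (auto simp: Orth_def St_def)
  let ?X = "St p N - E_sing N p S" and ?Q = "Q_skew N p" and ?f = "cayley N p S"
  define g where "g V = S * (1\<^sub>m N - V) * minv (1\<^sub>m N + V) * eye_cols N p" for V
  have coords: "\<exists>A B. cayley_coordinates p N S V A B" if V: "V \<in> ?Q" for V
  proof -
    obtain A B where "A \<in> carrier_mat p p" "transpose_mat A = - A" "B \<in> carrier_mat (N - p) p"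
      "V = four_block_mat A (- transpose_mat B) B (0\<^sub>m (N - p) (N - p))"
      using Q_skewE[OF V] .
    with assms have "cayley_coordinates p N S V A B" by unfold_locales
    then show ?thesis by blast
  qed
  have g_eq: "g V = cayley_coordinates.preimage p S A B" if "cayley_coordinates p N S V A B" for V A B
  proof -
    interpret cayley_coordinates p N S V A B by fact
    show ?thesis
      unfolding g_def cayley_inv_eye_cols inverse_append_rows inverse_blocks preimage_def ..
  qed
  have g: "g V \<in> ?X" "?f (g V) = V" if V: "V \<in> ?Q" for V
  proof -
    obtain A B where c: "cayley_coordinates p N S V A B" using coords[OF V] by blast
    show "g V \<in> ?X" "?f (g V) = V"
      unfolding g_eq[OF c] by (rule cayley_coordinates.cayley_preimage[OF c])+
  qed
  have f: "?f U \<in> ?Q" "g (?f U) = U" if U: "U \<in> ?X" for U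
  proof -
    note c = preimage_cayley[OF assms U]
    show "?f U \<in> ?Q"
      using c(1) unfolding cayley_coordinates_def Q_skew_def by blast
    show "g (?f U) = U"
      unfolding g_eq[OF c(1)] by (rule c(2))
  qed
  have bij: "bij_betw ?f ?X ?Q"
    by (rule bij_betw_byWitness[where f' = g]) (use f g in auto)
  have inv: "the_inv_into ?X ?f V = g V" if "V \<in> ?Q" for V
    using g[OF that] bij by (intro the_inv_into_f_eq) (auto simp: bij_betw_def)
  have det_V: "V \<in> carrier_mat N N" "det (1\<^sub>m N + V) \<noteq> 0" if "V \<in> ?Q" for V
    using coords[OF that] cayley_coordinates.V_carrier cayley_coordinates.det_one_plus_V by blast+
  have "smooth_on_mat N N N p ?Q (the_inv_into ?X ?f)"
    by (rule cayley_inverse_smooth[OF assms(1) Sc]) (use det_V inv in \<open>auto simp: g_def\<close>)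
  then show "diffeomorphism_mat N p N N ?X ?Q ?f"
    unfolding diffeomorphism_mat_def using bij cayley_smooth[OF assms(1) Sc] by simp
  fix V assume VQ: "V \<in> ?Q"
  obtain A B where "cayley_coordinates p N S V A B" using coords[OF VQ] by blast
  then interpret cayley_coordinates p N S V A B .
  have "invertible_mat (1\<^sub>m N + V)"
    by (rule invertible_mat_det[of _ N]) (use V_carrier det_one_plus_V in auto)
  moreover have "invertible_mat M"
    by (rule invertible_mat_det[OF M_carrier det_M])
  ultimately show "let \<Phi>_inv = the_inv_into ?X ?f;
          S_le = left_block p S;
          S_ri = right_block p S;
          V21 = block21 p V;
          M = 1\<^sub>m p + block11 p V + transpose_mat V21 * V21
      in invertible_mat (1\<^sub>m N + V) \<and>
         \<Phi>_inv V = (Xi N p \<circ> cayley_inv N S) V \<and>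
         \<Phi>_inv V = S * (1\<^sub>m N - V) * minv (1\<^sub>m N + V) * eye_cols N p \<and>
         \<Phi>_inv V = 2 \<cdot>\<^sub>m (S * minv (1\<^sub>m N + V) * eye_cols N p) - S * eye_cols N p \<and>
         M = schur_complement p (1\<^sub>m N + V) \<and>
         invertible_mat M \<and>
         \<Phi>_inv V = 2 \<cdot>\<^sub>m (S * (minv M @\<^sub>r (- (V21 * minv M)))) - S_le \<and>
         \<Phi>_inv V = 2 \<cdot>\<^sub>m ((S_le - S_ri * V21) * minv M) - S_le"
    unfolding Let_def blocks_V inv[OF VQ] schur_complement_one_plus_V M_def[symmetric]
    by (simp add: g_def Xi_def cayley_inv_def flip: cayley_inv_eye_cols inverse_append_rows inverse_blocks)
qed

end
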